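(* Let $(\mathbf{n}_\kappa)_{\kappa\ge 1}$ be a sequence of degree statistics such that, as $\kappa\to\infty$, $|\mathbf{n}_\kappa|\to\infty$ and, for every $i\ge 0$, $p_i(\mathbf{n}_\kappa)\to p_i$, where $\mathbf{p}=(p_i)_{i\ge 0}$ is a probability distribution on $\mathbb{N}_0$. Assume that the limit distribution $\mathbf{p}$ is not concentrated at $0$ or at $1$, i.e., $p_0,p_1<1$. For $\kappa\ge 1$, let $T_\kappa\in\mathbb{T}$ be such that $m_\kappa:=|T_\kappa|\to\infty$ as $\kappa\to\infty$. Then, as $\kappa\to\infty$: (i) If $|\mathbf{n}_\kappa|\,\pi_{\mathbf{p}(\mathbf{n}_\kappa)}(T_\kappa)\to\lambda$, for some $\lambda\in[0,\infty)$, then $$N_{T_\kappa}(\mathcal{T}_{\mathbf{n}_\kappa})\overset{\mathrm{d}}{\longrightarrow}\mathrm{Po}(\lambda)$$ with convergence of all moments. (ii) If $|\mathbf{n}_\kappa|\,\pi_{\mathbf{p}(\mathbf{n}_\kappa)}(T_\kappa)\to\infty$, then $$\frac{N_{T_\kappa}(\mathcal{T}_{\mathbf{n}_\kappa})-|\mathbf{n}_\kappa|\,\pi_{\mathbf{p}(\mathbf{n}_\kappa)}(T_\kappa)}{\sqrt{|\mathbf{n}_\kappa|\,\pi_{\mathbf{p}(\mathbf{n}_\kappa)}(T_\kappa)}}\overset{\mathrm{d}}{\longrightarrow}\mathrm{N}(0,1),$$ with convergence of mean and variance. Thus, in both cases, $$\mathbb{E}\bigl[N_{T_\kappa}(\mathcal{T}_{\mathbf{n}_\kappa})\bigr]\sim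 \mathrm{Var}\bigl[N_{T_\kappa}(\mathcal{T}_{\mathbf{n}_\kappa})\bigr]\sim|\mathbf{n}_\kappa|\,\pi_{\mathbf{p}(\mathbf{n}_\kappa)}(T_\kappa).$$
   Context: $\mathbb{N}_0=\{0,1,2,\dots\}$. $\mathbb{T}$ is the set of all finite rooted plane (ordered) trees; $|T|$ is the number of vertices of $T$, and $d_T(v)$ is the (out)degree, i.e. number of children, of $v\in T$. The degree statistic of $T$ is $\mathbf{n}_T=(n_T(i))_{i\ge 0}$ with $n_T(i)=\#\{v\in T: d_T(v)=i\}$. A sequence $\mathbf{n}=(n(i))_{i\ge 0}$ of nonnegative integers is called a degree statistic if $\sum_{i\ge 0}n(i)=1+\sum_{i\ge 0}i\,n(i)$ (finite sums); equivalently, it is the degree statistic of some tree. Put $|\mathbf{n}|=\sum_{i\ge 0} n(i)$; the empirical degree distribution is $\mathbf{p}(\mathbf{n})=(p_i(\mathbf{n}))_{i\ge 0}$ with $p_i(\mathbf{n})=n(i)/|\mathbf{n}|$. $\mathbb{T}_{\mathbf{n}}$ is the set of plane rooted trees with degree statistic $\mathbf{n}$, and $\mathcal{T}_{\mathbf{n}}$ is a uniformly random element of $\mathbb{T}_{\mathbf{n}}$. For $v\in T$, the fringe tree $T_v$ is the subtree of $T$ rooted at $v$ consisting of $v$ and all its descendants. For $T,T'\in\mathbb{T}$, $N_{T'}(T)=\#\{v\in T: T_v=T'\}$, where equality means isomorphism as plane rooted trees. For a probability distribution $\mathbf{p}$ on $\mathbb{N}_0$ and $T\in\mathbb{T}$,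 $\pi_{\mathbf{p}}(T)=\prod_{i\ge 0}p_i^{n_T(i)}$ (with $0^0=1$). $\overset{\mathrm{d}}{\longrightarrow}$ denotes convergence in distribution; $\mathrm{Po}(\lambda)$ is the Poisson distribution with parameter $\lambda$ ($\mathrm{Po}(0)$ being the point mass at $0$); $\mathrm{N}(0,1)$ is the standard normal distribution. Convergence of moments (or of mean and variance) means convergence to the corresponding quantities of the limit distribution. The symbol $\sim$ denotes asymptotic equivalence as $\kappa\to\infty$.
   Formalization: In case (i) the final relation Var ~ |n_κ|π(T_κ) (hence E ~ |n_κ|π(T_κ)) is stated only for λ > 0, since it can fail for λ = 0 (E = Var = 0 while |n_κ|π(T_κ) > 0); E ~ Var is kept for all λ ≥ 0. *)

theory Defs
  imports "HOL-Probability.Probability" "HOL-Library.Landau_Symbols"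
begin

section \<open>Plane trees\<close>

text \<open>
  A finite rooted plane tree is given by the ordered list of the subtrees at the children of its
  root, so isomorphism of plane rooted trees is equality. Vertices are Ulam--Harris addresses:
  \<^term>\<open>[]\<close> is the root, and \<^term>\<open>i # v\<close> is the vertex \<^term>\<open>v\<close> of the subtree at the
  \<^term>\<open>i\<close>-th child of the root (counting from \<^term>\<open>0::nat\<close>).
\<close>

datatype ptree = Node (children: "ptree list")

fun is_vertex :: "ptree \<Rightarrow> nat list \<Rightarrow> bool" where
  "is_vertex T [] = True"
| "is_vertex T (i # v) = (i < length (children T) \<and> is_vertex (children T ! i) v)"

definition vertices :: "ptree \<Rightarrow> nat list set" where
  "vertices T = {v. is_vertex T v}"

definition tree_size :: "ptree \<Rightarrow> nat" where
  "tree_size T = card (vertices T)"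

text \<open>The value of \<open>fringe_tree T v\<close> is meaningful only for \<^term>\<open>v \<in> vertices T\<close>.\<close>

fun fringe_tree :: "ptree \<Rightarrow> nat list \<Rightarrow> ptree" where
  "fringe_tree T [] = T"
| "fringe_tree T (i # v) = fringe_tree (children T ! i) v"

definition outdegree :: "ptree \<Rightarrow> nat list \<Rightarrow> nat" where
  "outdegree T v = length (children (fringe_tree T v))"

definition fringe_count :: "ptree \<Rightarrow> ptree \<Rightarrow> nat" where
  "fringe_count S T = card {v \<in> vertices T. fringe_tree T v = S}"


section \<open>Degree statistics\<close>

definition tree_deg_stat :: "ptree \<Rightarrow> nat \<Rightarrow> nat" where
  "tree_deg_stat T i = card {v \<in> vertices T. outdegree T v = i}"

definition is_deg_stat :: "(nat \<Rightarrow> nat) \<Rightarrow> bool" where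
  "is_deg_stat n \<longleftrightarrow>
     finite {i. n i \<noteq> 0} \<and> (\<Sum>i | n i \<noteq> 0. n i) = 1 + (\<Sum>i | n i \<noteq> 0. i * n i)"

definition stat_size :: "(nat \<Rightarrow> nat) \<Rightarrow> nat" where
  "stat_size n = (\<Sum>i | n i \<noteq> 0. n i)"

definition emp_dist :: "(nat \<Rightarrow> nat) \<Rightarrow> nat \<Rightarrow> real" where
  "emp_dist n i = real (n i) / real (stat_size n)"

text \<open>
  The product runs over the finitely many degrees occurring in \<^term>\<open>T\<close>; all other factors are
  zeroth powers, hence equal to \<^term>\<open>1::real\<close>.
\<close>

definition tree_weight :: "(nat \<Rightarrow> real) \<Rightarrow> ptree \<Rightarrow> real" where
  "tree_weight q T = (\<Prod>i | tree_deg_stat T i \<noteq> 0. q i ^ tree_deg_stat T i)"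

definition trees_with_stat :: "(nat \<Rightarrow> nat) \<Rightarrow> ptree set" where
  "trees_with_stat n = {T. tree_deg_stat T = n}"

text \<open>
  The set \<^term>\<open>trees_with_stat n\<close> is finite, and it is nonempty whenever \<^term>\<open>n\<close> is a degree
  statistic, so that \<^const>\<open>pmf_of_set\<close> is then the uniform distribution on it.
\<close>

definition random_tree :: "(nat \<Rightarrow> nat) \<Rightarrow> ptree pmf" where
  "random_tree n = pmf_of_set (trees_with_stat n)"


section \<open>Fringe tree counts in random trees\<close>

text \<open>The quantity \<open>|n| \<pi>\<^sub>p\<^sub>(\<^sub>n\<^sub>)(S)\<close>.\<close>

definition fringe_param :: "(nat \<Rightarrow> nat) \<Rightarrow> ptree \<Rightarrow> real" where
  "fringe_param n S = real (stat_size n) * tree_weight (emp_dist n) S"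

definition fringe_mean :: "(nat \<Rightarrow> nat) \<Rightarrow> ptree \<Rightarrow> real" where
  "fringe_mean n S =
     measure_pmf.expectation (random_tree n) (\<lambda>T. real (fringe_count S T))"

definition fringe_var :: "(nat \<Rightarrow> nat) \<Rightarrow> ptree \<Rightarrow> real" where
  "fringe_var n S =
     measure_pmf.variance (random_tree n) (\<lambda>T. real (fringe_count S T))"

definition normalized_count :: "(nat \<Rightarrow> nat) \<Rightarrow> ptree \<Rightarrow> ptree \<Rightarrow> real" where
  "normalized_count n S T =
     (real (fringe_count S T) - fringe_param n S) / sqrt (fringe_param n S)"

text \<open>The law of a real random variable on a discrete probability space.\<close>

definition law :: "'a pmf \<Rightarrow> ('a \<Rightarrow> real) \<Rightarrow> real measure" where
  "law P X = distr (measure_pmf P) borel X"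

text \<open>The library's \<^const>\<open>poisson_pmf\<close> is only specified for positive rates.\<close>

definition Po :: "real \<Rightarrow> nat pmf" where
  "Po r = (if r = 0 then return_pmf 0 else poisson_pmf r)"

end

theory Submission
  imports Defs "HOL-Complex_Analysis.Complex_Analysis"
begin

text \<open>
  Fix a tree \<open>S\<close> with \<open>m\<close> vertices and degree statistic \<open>s\<close>, a degree statistic \<open>n\<close> of size \<open>N\<close>, and
  let \<open>X\<close> be the number of fringe trees equal to \<open>S\<close> in a uniform tree with degree statistic \<open>n\<close>.
  Everything rests on one exact formula. Two distinct fringe trees equal to \<open>S\<close> are disjoint, so the
  \<open>r\<close>-th factorial moment of \<open>X\<close> counts trees in which \<open>r\<close> copies of \<open>S\<close> are selected; contracting the
  copies to marked leaves leaves a tree with \<open>N - r (m - 1)\<close> vertices whose degree counts are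
  \<open>n - r s\<close>, apart from the \<open>r\<close> marks. Trees with prescribed degrees are counted by a multinomial
  coefficient, whence
  \<open>E (X)\<^sub>r = (\<Prod>i. (n i) falling (r s i)) / ((N - 1) falling (r (m - 1)))\<close>.
  The counting is carried out for forests, where removing the root of the first tree gives a
  recursion (\<open>forest_moment_Suc\<close>) that the closed form satisfies (\<open>forest_moment_eq\<close>); this
  avoids both the bijection and the cycle lemma.

  Consecutive factorial moments therefore have an explicit ratio \<open>\<rho> r\<close>, a rational function of \<open>r\<close>
  which formally resembles the parameter \<open>\<mu> = N \<pi>(S)\<close>. Since the limiting degree distribution is not
  concentrated at \<open>0\<close> or \<open>1\<close>, all \<open>n i\<close> are at most \<open>q N\<close> for some \<open>q < 1\<close>. One of the factors of
  \<open>\<mu>\<close> is \<open>n i / N\<close> for each degree \<open>i\<close> of \<open>S\<close>, and the \<open>m - 1\<close> others are at most \<open>q\<close>, so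
  \<open>n i \<ge> \<mu> / q ^ (m - 1)\<close>: the relevant degrees are exponentially more frequent than they are
  needed. This gives \<open>\<rho> r = \<mu> (1 + O((\<bar>r\<bar> + 1) \<epsilon> / \<mu>))\<close> with \<open>\<epsilon> = m\<^sup>2 q ^ (m - 1) \<rightarrow> 0\<close>, even for complex
  \<open>r\<close>, as long as \<open>(\<bar>r\<bar> + 1) \<epsilon> / \<mu>\<close> is small (\<open>rel_ratio_bound\<close>). If \<open>\<mu> \<rightarrow> 0\<close>, this bound is void and
  a cruder one shows \<open>\<rho> r \<rightarrow> 0\<close>, as far as \<open>r + 1\<close> copies of \<open>S\<close> fit into \<open>n\<close>.

  If \<open>\<mu>\<close> converges to \<open>\<lambda>\<close>, then \<open>\<rho> r \<rightarrow> \<lambda>\<close> for each \<open>r\<close>, so the factorial moments converge to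
  those of the Poisson distribution, hence so do all moments, and the method of moments applies.
  If \<open>\<mu> \<rightarrow> \<infinity>\<close>, convergence of \<open>E (X)\<^sub>r / \<mu> ^ r\<close> to \<open>1\<close> for fixed \<open>r\<close> is too weak, because the central
  moments of order \<open>j\<close> arise by cancellation of terms that are larger by a factor \<open>\<mu> ^ (j / 2)\<close>.
  What is needed is that the \<open>a\<close>-th finite difference in \<open>r\<close> of \<open>E (X)\<^sub>r / \<mu> ^ r\<close> is
  \<open>o(\<mu> ^ (- a / 2))\<close> for \<open>a \<ge> 1\<close>. As the first difference of \<open>E (X)\<^sub>r / \<mu> ^ r\<close> is its product with
  \<open>\<rho> r / \<mu> - 1\<close>, this comes down to \<open>b\<close>-th differences \<open>o(\<mu> ^ (- (b + 1) / 2))\<close> of \<open>\<rho> r / \<mu> - 1\<close>. That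
  function is holomorphic and \<open>O(\<epsilon> / sqrt \<mu>)\<close> on the disc \<open>\<bar>r\<bar> < sqrt \<mu>\<close>, and Cauchy's estimate gains a
  factor \<open>1 / sqrt \<mu>\<close> with every difference (\<open>cdiff_tendsto_0\<close>). The moments
  \<open>E ((X)\<^sub>r (X - r - \<mu>) ^ j) / \<mu> ^ r\<close> satisfy a recursion in \<open>j\<close> whose limit is the recursion of the
  Gaussian moments (\<open>gaussian_recursion_tendsto\<close>).

  Mean and variance are read off from the first two factorial moments. That they remain
  equivalent when \<open>\<mu> \<rightarrow> 0\<close> is the reason why \<open>\<rho> 1 \<rightarrow> 0\<close> is shown in that case, and not just \<open>E X \<rightarrow> 0\<close>.
\<close>


section \<open>Fringe trees and forests\<close>

lemma vertices_Node:
  "vertices (Node ts) = insert [] (\<Union>j<length ts. (#) j ` vertices (ts ! j))"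
proof (rule set_eqI)
  fix v show "v \<in> vertices (Node ts) \<longleftrightarrow> v \<in> insert [] (\<Union>j<length ts. (#) j ` vertices (ts ! j))"
    by (cases v) (auto simp: vertices_def)
qed

lemma finite_vertices: "finite (vertices T)"
proof (induction T)
  case (Node ts)
  then show ?case by (auto simp: vertices_Node)
qed

text \<open>
  The common source of the recursions for degree statistic, fringe count and size along the
  children of the root: all three count vertices by a property of their fringe tree.
\<close>

lemma card_vertices_Node:
  "card {v \<in> vertices (Node ts). Q (fringe_tree (Node ts) v)} =
     of_bool (Q (Node ts)) + (\<Sum>t\<leftarrow>ts. card {v \<in> vertices t. Q (fringe_tree t v)})"
proof -
  define A where "A j = {v \<in> vertices (ts ! j). Q (fringe_tree (ts ! j) v)}" for j
  define R where "R = (if Q (Node ts) then {[] :: nat list} else {})"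
  have fin: "finite (A j)" for j
    by (simp add: A_def finite_vertices)
  have "{v \<in> vertices (Node ts). Q (fringe_tree (Node ts) v)} =
      R \<union> (\<Union>j<length ts. (#) j ` A j)"
    by (auto simp: vertices_Node A_def R_def)
  also have "card \<dots> = card R + card (\<Union>j<length ts. (#) j ` A j)"
    by (rule card_Un_disjoint) (auto simp: fin R_def)
  also have "card (\<Union>j<length ts. (#) j ` A j) = (\<Sum>j<length ts. card (A j))"
    by (subst card_UN_disjoint) (auto simp: fin card_image)
  also have "\<dots> = (\<Sum>t\<leftarrow>ts. card {v \<in> vertices t. Q (fringe_tree t v)})"
    by (simp add: sum_list_sum_nth A_def lessThan_atLeast0)
  finally show ?thesis by (simp add: R_def)
qed

lemma tree_deg_stat_Node:
  "tree_deg_stat (Node ts) i = of_bool (length ts = i) + (\<Sum>t\<leftarrow>ts. tree_deg_stat t i)"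
  unfolding tree_deg_stat_def outdegree_def
  using card_vertices_Node[of ts "\<lambda>t. length (children t) = i"] by simp

lemma fringe_count_Node:
  "fringe_count S (Node ts) = of_bool (Node ts = S) + (\<Sum>t\<leftarrow>ts. fringe_count S t)"
  unfolding fringe_count_def using card_vertices_Node[of ts "\<lambda>t. t = S"] by simp

lemma tree_size_Node: "tree_size (Node ts) = Suc (\<Sum>t\<leftarrow>ts. tree_size t)"
  unfolding tree_size_def using card_vertices_Node[of ts "\<lambda>t. True"] by simp

lemma tree_size_pos: "tree_size T > 0"
  by (cases T) (simp add: tree_size_Node)

text \<open>
  A tree has no fringe tree larger than itself. Applied to the children of the root, this says that
  copies of one and the same tree do not overlap.
\<close>

lemma fringe_count_larger:
  assumes "tree_size T < tree_size S"
  shows "fringe_count S T = 0"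
  using assms
proof (induction T)
  case (Node ts)
  have "tree_size t < tree_size S" if "t \<in> set ts" for t
    using Node.prems member_le_sum_list[of "tree_size t" "map tree_size ts"] that
    by (simp add: tree_size_Node)
  then show ?case using Node by (auto simp: fringe_count_Node)
qed

definition forest_stat :: "ptree list \<Rightarrow> nat \<Rightarrow> nat" where
  "forest_stat ts i = (\<Sum>t\<leftarrow>ts. tree_deg_stat t i)"

definition forest_count :: "ptree \<Rightarrow> ptree list \<Rightarrow> nat" where
  "forest_count S ts = (\<Sum>t\<leftarrow>ts. fringe_count S t)"

definition forests :: "(nat \<Rightarrow> nat) \<Rightarrow> nat \<Rightarrow> ptree list set" where
  "forests n k = {ts. length ts = k \<and> forest_stat ts = n}"

lemma forest_stat_simps [simp]:
  "forest_stat [] = (\<lambda>_. 0)"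
  "forest_stat (t # ts) i = tree_deg_stat t i + forest_stat ts i"
  "forest_stat (us @ ts) i = forest_stat us i + forest_stat ts i"
  by (auto simp: forest_stat_def)

lemma forest_count_simps [simp]:
  "forest_count S [] = 0"
  "forest_count S (t # ts) = fringe_count S t + forest_count S ts"
  "forest_count S (us @ ts) = forest_count S us + forest_count S ts"
  by (auto simp: forest_count_def)

lemma tree_deg_stat_Node': "tree_deg_stat (Node ts) i = of_bool (length ts = i) + forest_stat ts i"
  by (simp add: tree_deg_stat_Node forest_stat_def)

lemma fringe_count_Node': "fringe_count S (Node ts) = of_bool (Node ts = S) + forest_count S ts"
  by (simp add: fringe_count_Node forest_count_def)

lemma tree_deg_stat_support: "{i. tree_deg_stat T i \<noteq> 0} = outdegree T ` vertices T"
  by (auto simp: tree_deg_stat_def card_gt_0_iff finite_vertices)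

lemma finite_tree_deg_stat: "finite {i. tree_deg_stat T i \<noteq> 0}"
  unfolding tree_deg_stat_support by (simp add: finite_vertices)

lemma sum_tree_deg_stat:
  assumes "{i. tree_deg_stat T i \<noteq> 0} \<subseteq> I" "finite I"
  shows "(\<Sum>i\<in>I. tree_deg_stat T i) = tree_size T"
proof -
  have "vertices T = (\<Union>i\<in>I. {v \<in> vertices T. outdegree T v = i})"
    using assms unfolding tree_deg_stat_support by auto
  then have "card (vertices T) = card (\<Union>i\<in>I. {v \<in> vertices T. outdegree T v = i})"
    by simp
  also have "\<dots> = (\<Sum>i\<in>I. tree_deg_stat T i)"
    unfolding tree_deg_stat_def using assms
    by (subst card_UN_disjoint) (auto simp: finite_vertices)
  finally show ?thesis by (simp add: tree_size_def)
qed

text \<open>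
  A tree with \<open>m\<close> vertices has \<open>m - 1\<close> edges, each counted at its upper end.
\<close>

lemma tree_deg_stat_balance:
  assumes "finite I" "\<And>i. tree_deg_stat T i \<noteq> 0 \<Longrightarrow> i \<in> I"
  shows "(\<Sum>i\<in>I. tree_deg_stat T i) = 1 + (\<Sum>i\<in>I. i * tree_deg_stat T i)"
  using assms
proof (induction T)
  case (Node ts)
  have sub: "\<forall>t\<in>set ts. \<forall>i. tree_deg_stat t i \<noteq> 0 \<longrightarrow> i \<in> I"
  proof (intro ballI allI impI)
    fix t i assume "t \<in> set ts" "tree_deg_stat t i \<noteq> 0"
    then have "(\<Sum>t\<leftarrow>ts. tree_deg_stat t i) \<noteq> 0"
      by (auto simp: sum_list_eq_0_iff)
    then show "i \<in> I"
      by (intro Node.prems) (simp add: tree_deg_stat_Node)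
  qed
  have "length ts \<in> I" by (intro Node.prems) (simp add: tree_deg_stat_Node)
  have "(\<Sum>i\<in>I. (\<Sum>t\<leftarrow>us. tree_deg_stat t i)) = length us + (\<Sum>i\<in>I. i * (\<Sum>t\<leftarrow>us. tree_deg_stat t i))"
    if "set us \<subseteq> set ts" for us
    using that
  proof (induction us)
    case (Cons u us)
    then have "(\<Sum>i\<in>I. tree_deg_stat u i) = 1 + (\<Sum>i\<in>I. i * tree_deg_stat u i)"
      using sub Node.IH[of u] Node.prems(1) by auto
    then show ?case using Cons by (simp add: sum.distrib algebra_simps)
  qed simp
  from this[of ts] show ?case
    using \<open>length ts \<in> I\<close> Node.prems(1)
    by (simp add: tree_deg_stat_Node sum.distrib distrib_left of_bool_def if_distrib[of "(*) _"] eq_commute cong: if_cong)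
qed

lemma forests_0: "forests n 0 = (if n = (\<lambda>_. 0) then {[]} else {})"
  by (auto simp: forests_def)

text \<open>
  Deleting the root of the first tree and putting its children in its place turns a nonempty forest
  into a forest with one vertex less; the degree \<open>i\<close> of the deleted root suffices to undo this.
\<close>

lemma forests_Suc:
  "bij_betw (\<lambda>(i, ts). Node (take i ts) # drop i ts)
     (SIGMA i:{i. n i \<noteq> 0}. forests (n(i := n i - 1)) (k + i)) (forests n (Suc k))"
proof (rule bij_betwI[where g = "\<lambda>ts. (length (children (hd ts)), children (hd ts) @ tl ts)"])
  show "(\<lambda>(i, ts). Node (take i ts) # drop i ts)
      \<in> (SIGMA i:{i. n i \<noteq> 0}. forests (n(i := n i - 1)) (k + i)) \<rightarrow> forests n (Suc k)"
  proof (rule funcsetI, clarify)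
    fix i ts assume "ts \<in> forests (n(i := n i - 1)) (k + i)" and "0 < n i"
    then have *: "n i \<noteq> 0" "ts \<in> forests (n(i := n i - 1)) (k + i)" by auto
    have "forest_stat (take i ts) j + forest_stat (drop i ts) j = (n(i := n i - 1)) j" for j
      using * forest_stat_simps(3)[of "take i ts" "drop i ts" j] by (simp add: forests_def)
    then have "forest_stat (Node (take i ts) # drop i ts) j = n j" for j
      using * by (auto simp: forests_def tree_deg_stat_Node' fun_upd_def split: if_splits)
    then show "Node (take i ts) # drop i ts \<in> forests n (Suc k)"
      using * by (auto simp: forests_def fun_eq_iff)
  qed
next
  show "(\<lambda>ts. (length (children (hd ts)), children (hd ts) @ tl ts)) \<in> forests n (Suc k) \<rightarrow>
      (SIGMA i:{i. n i \<noteq> 0}. forests (n(i := n i - 1)) (k + i))"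
  proof
    fix ts assume "ts \<in> forests n (Suc k)"
    then obtain t rest where "ts = t # rest" "length rest = k" "forest_stat (t # rest) = n"
      by (cases ts) (auto simp: forests_def)
    moreover obtain us where "t = Node us" by (cases t)
    ultimately have ts: "ts = Node us # rest" "length rest = k"
      and n: "forest_stat (Node us # rest) = n" by simp_all
    show "(length (children (hd ts)), children (hd ts) @ tl ts) \<in>
        (SIGMA i:{i. n i \<noteq> 0}. forests (n(i := n i - 1)) (k + i))"
      using ts by (auto simp: forests_def n[symmetric] fun_eq_iff tree_deg_stat_Node')
  qed
next
  fix ts assume "ts \<in> forests n (Suc k)"
  then obtain t rest where "ts = t # rest" by (cases ts) (auto simp: forests_def)
  then show "(\<lambda>(i, ts). Node (take i ts) # drop i ts)
      (length (children (hd ts)), children (hd ts) @ tl ts) = ts" by simp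
qed (auto simp: forests_def)

lemma finite_forests:
  assumes "finite {i. n i \<noteq> 0}"
  shows "finite (forests n k)"
  using assms
proof (induction "\<Sum>i | n i \<noteq> 0. n i" arbitrary: n k rule: less_induct)
  case less
  show ?case
  proof (cases k)
    case 0
    then show ?thesis by (simp add: forests_0)
  next
    case (Suc k')
    have "finite (forests (n(i := n i - 1)) (k' + i))" if i: "n i \<noteq> 0" for i
    proof -
      have sub: "{j. (n(i := n i - 1)) j \<noteq> 0} \<subseteq> {j. n j \<noteq> 0}"
        using i by auto
      have "(\<Sum>j | (n(i := n i - 1)) j \<noteq> 0. (n(i := n i - 1)) j) = (\<Sum>j | n j \<noteq> 0. (n(i := n i - 1)) j)"
        using less.prems sub by (intro sum.mono_neutral_left) auto
      also have "\<dots> < (\<Sum>j | n j \<noteq> 0. n j)"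
        using less.prems i by (intro sum_strict_mono_ex1) auto
      finally show ?thesis
        using less.hyps finite_subset[OF sub less.prems] by blast
    qed
    then have "finite (SIGMA i:{i. n i \<noteq> 0}. forests (n(i := n i - 1)) (k' + i))"
      using less.prems by (intro finite_SigmaI) auto
    then show ?thesis
      unfolding Suc using bij_betw_finite[OF forests_Suc[of n k']] by blast
  qed
qed

text \<open>
  The sum over the forests with \<open>k\<close> trees and statistic \<open>n\<close> of the number of ways to select \<open>r\<close> copies
  of \<open>S\<close> among their fringe trees.
\<close>

definition forest_moment :: "ptree \<Rightarrow> nat \<Rightarrow> (nat \<Rightarrow> nat) \<Rightarrow> nat \<Rightarrow> nat" where
  "forest_moment S r n k = (\<Sum>ts\<in>forests n k. forest_count S ts choose r)"

lemma forest_count_children: "forest_count S (children S) = 0"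
proof (cases S)
  case (Node us)
  have "fringe_count S t = 0" if "t \<in> set us" for t
    using that member_le_sum_list[of "tree_size t" "map tree_size us"] Node
    by (intro fringe_count_larger) (simp add: tree_size_Node)
  then show ?thesis by (simp add: Node forest_count_def)
qed

lemma forests_starting_with:
  assumes "\<And>i. tree_deg_stat S i \<le> n i"
  shows "{ts \<in> forests n (Suc k). hd ts = S} = (#) S ` forests (\<lambda>i. n i - tree_deg_stat S i) k"
proof (rule set_eqI)
  fix ts
  show "ts \<in> {ts \<in> forests n (Suc k). hd ts = S} \<longleftrightarrow>
      ts \<in> (#) S ` forests (\<lambda>i. n i - tree_deg_stat S i) k"
  proof (cases ts)
    case (Cons t rest)
    have "(\<forall>i. tree_deg_stat S i + forest_stat rest i = n i) \<longleftrightarrow>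
        (\<forall>i. forest_stat rest i = n i - tree_deg_stat S i)"
      using assms by (metis add_diff_cancel_left' le_add_diff_inverse)
    then show ?thesis by (auto simp: Cons forests_def fun_eq_iff image_iff)
  qed (auto simp: forests_def)
qed

text \<open>
  If the first tree is not \<open>S\<close>, deleting its root does not change the count. If it is \<open>S\<close>, then the
  count drops by one and the children of the deleted root contribute nothing, so Pascal's rule
  produces an additional term: the whole first tree is removed together with one selected copy.
\<close>

lemma forest_moment_Suc:
  assumes fin: "finite {i. n i \<noteq> 0}"
  shows "forest_moment S r n (Suc k) =
     (\<Sum>i | n i \<noteq> 0. forest_moment S r (n(i := n i - 1)) (k + i)) +
     (if r > 0 \<and> (\<forall>i. tree_deg_stat S i \<le> n i)
      then forest_moment S (r - 1) (\<lambda>i. n i - tree_deg_stat S i) k else 0)"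
proof -
  define w where "w ts = forest_count S (children (hd ts) @ tl ts)" for ts
  define A where "A = {ts \<in> forests n (Suc k). hd ts = S}"
  have finF: "finite (forests n k)" for k
    by (rule finite_forests[OF fin])
  have fm: "forest_count S ts choose r = (w ts choose r) +
      (if hd ts = S \<and> r > 0 then forest_count S (tl ts) choose (r - 1) else 0)"
    if ts_in: "ts \<in> forests n (Suc k)" for ts
  proof -
    obtain t rest where "ts = t # rest" using ts_in by (cases ts) (auto simp: forests_def)
    moreover obtain us where "t = Node us" by (cases t)
    ultimately have ts: "ts = Node us # rest" by simp
    show ?thesis
    proof (cases "Node us = S")
      case True
      then have "forest_count S us = 0"
        using forest_count_children[of S] by (metis ptree.sel)
      then show ?thesis
        using True by (cases r) (auto simp: ts w_def fringe_count_Node')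
    qed (simp add: ts w_def fringe_count_Node')
  qed
  have "forest_moment S r n (Suc k) = (\<Sum>ts\<in>forests n (Suc k). w ts choose r) +
     (\<Sum>ts\<in>forests n (Suc k). if hd ts = S \<and> r > 0 then forest_count S (tl ts) choose (r - 1) else 0)"
    unfolding forest_moment_def sum.distrib[symmetric] by (intro sum.cong fm) auto
  also have "(\<Sum>ts\<in>forests n (Suc k). w ts choose r) =
      (\<Sum>(i, ts)\<in>(SIGMA i:{i. n i \<noteq> 0}. forests (n(i := n i - 1)) (k + i)). forest_count S ts choose r)"
    by (subst sum.reindex_bij_betw[OF forests_Suc, symmetric], rule sum.cong)
      (auto simp: w_def simp flip: forest_count_simps(3))
  also have "\<dots> = (\<Sum>i | n i \<noteq> 0. forest_moment S r (n(i := n i - 1)) (k + i))"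
    unfolding forest_moment_def using fin
    by (subst sum.Sigma) (auto intro!: finite_forests elim: finite_subset[rotated])
  also have "(\<Sum>ts\<in>forests n (Suc k). if hd ts = S \<and> r > 0 then forest_count S (tl ts) choose (r - 1) else 0)
      = (if r > 0 then (\<Sum>ts\<in>A. forest_count S (tl ts) choose (r - 1)) else 0)"
    using finF[of "Suc k"] by (auto simp: A_def sum.inter_filter simp del: One_nat_def)
  also have "(\<Sum>ts\<in>A. forest_count S (tl ts) choose (r - 1)) = 
      (if \<forall>i. tree_deg_stat S i \<le> n i
      then forest_moment S (r - 1) (\<lambda>i. n i - tree_deg_stat S i) k else 0)"
  proof (cases "\<forall>i. tree_deg_stat S i \<le> n i")
    case True
    then have "A = (#) S ` forests (\<lambda>i. n i - tree_deg_stat S i) k"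
      unfolding A_def by (intro forests_starting_with) auto
    then show ?thesis using True by (simp add: sum.reindex forest_moment_def)
  next
    case False
    then have "A = {}"
      by (auto simp: A_def forests_def length_Suc_conv)
    then show ?thesis unfolding if_not_P[OF False] by simp
  qed
  finally show ?thesis
    by (cases "r > 0"; cases "\<forall>i. tree_deg_stat S i \<le> n i")
      (simp_all only: simp_thms if_True if_False)
qed

lemma forest_moment_0: "forest_moment S r n 0 = of_bool (n = (\<lambda>_. 0) \<and> r = 0)"
  by (cases r) (auto simp: forest_moment_def forests_0)

text \<open>
  With \<open>t\<close> the number of vertices after contraction of the selected copies, this is \<open>t! k / t\<close>, the
  proportion \<open>k / t\<close> of all arrangements of a multiset of \<open>t\<close> degrees that encode a forest with \<open>k\<close> trees.
  The value at \<open>t = 0\<close> belongs to the empty forest.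
\<close>

definition forest_weight :: "nat \<Rightarrow> nat \<Rightarrow> real" where
  "forest_weight k t = (if t = 0 then 1 else real k * fact (t - 1))"

text \<open>
  Otter's formula for forests with two kinds of leaves, ordinary ones and \<open>r\<close> marked ones. Write \<open>c\<close> for
  the counts \<open>n - r s\<close> and \<open>t\<close> for their sum plus \<open>r\<close>. The recursion \<open>forest_moment_Suc\<close> removes one letter:
  a degree \<open>i\<close>, replacing \<open>k\<close> by \<open>k - 1 + i\<close>, or a mark, replacing \<open>k\<close> by \<open>k - 1\<close>. Hence the closed form
  is verified by \<open>\<Sum>i. c i (k - 1 + i) + r (k - 1) = (k - 1) t + (t - k) = k (t - 1)\<close>, where
  \<open>\<Sum>i. i c i = t - k\<close> is the balance of vertices and edges.
\<close>

theorem forest_moment_eq: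
  fixes S r n k I
  defines "s \<equiv> tree_deg_stat S"
  assumes I: "finite I" "\<And>i. n i \<noteq> 0 \<Longrightarrow> i \<in> I"
    and bal: "(\<Sum>i\<in>I. n i) = k + (\<Sum>i\<in>I. i * n i)"
  shows "real (forest_moment S r n k) =
     (if \<forall>i. r * s i \<le> n i
      then forest_weight k (r + (\<Sum>i\<in>I. n i - r * s i)) / (fact r * (\<Prod>i\<in>I. fact (n i - r * s i)))
      else 0)"
  using I(2) bal
proof (induction "\<Sum>i\<in>I. n i" arbitrary: n k r rule: less_induct)
  case less
  have finn: "finite {i. n i \<noteq> 0}"
    using less.prems(1) I(1) by (rule_tac finite_subset[of _ I]) auto
  show ?case
  proof (cases k)
    case 0
    show ?thesis
    proof (cases "n = (\<lambda>_. 0)")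
      case True
      have "s (length (children S)) \<noteq> 0"
        using tree_deg_stat_Node[of "children S" "length (children S)"] by (simp add: s_def)
      then obtain i where "s i \<noteq> 0" ..
      then show ?thesis using 0 True
        by (auto simp: forest_moment_0 forest_weight_def)
    next
      case False
      then obtain i where "n i \<noteq> 0" by auto
      then have "(\<Sum>i\<in>I. n i) \<noteq> 0" using less.prems(1) I(1) by auto
      have "r + (\<Sum>i\<in>I. n i - r * s i) \<noteq> 0"
        using \<open>(\<Sum>i\<in>I. n i) \<noteq> 0\<close> by (cases r) auto
      then have "forest_weight 0 (r + (\<Sum>i\<in>I. n i - r * s i)) = 0"
        by (auto simp: forest_weight_def)
      then show ?thesis using 0 False by (simp add: forest_moment_0)
    qed
  next
    case (Suc k')
    \<comment> \<open>The statistics that remain after removing a root of degree \<open>i\<close>, or a whole copy of \<open>S\<close>.\<close>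
    define n1 where "n1 i = n(i := n i - 1)" for i
    define n2 where "n2 = (\<lambda>i. n i - s i)"
    have n1_supp: "n1 i j \<noteq> 0 \<Longrightarrow> j \<in> I" for i j
      using less.prems(1)[of j] less.prems(1)[of i] by (auto simp: n1_def split: if_splits)
    have n1_sum: "(\<Sum>j\<in>I. g j * n1 i j) + g i = (\<Sum>j\<in>I. g j * n j)" if "n i \<noteq> 0" for g :: "nat \<Rightarrow> nat" and i
    proof -
      have "i \<in> I" using that less.prems(1) by auto
      define u where "u = n i - 1"
      have u: "n i = Suc u" using that by (simp add: u_def)
      have "(\<Sum>j\<in>I. g j * n1 i j) + g i = (\<Sum>j\<in>I. g j * n1 i j + (if j = i then g i else 0))"
        using \<open>i \<in> I\<close> I(1) by (simp add: sum.distrib)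
      also have "\<dots> = (\<Sum>j\<in>I. g j * n j)"
        by (intro sum.cong) (auto simp: n1_def u)
      finally show ?thesis .
    qed
    have IH1: "real (forest_moment S r (n1 i) (k' + i)) =
       (if \<forall>j. r * s j \<le> n1 i j
        then forest_weight (k' + i) (r + (\<Sum>j\<in>I. n1 i j - r * s j)) / (fact r * (\<Prod>j\<in>I. fact (n1 i j - r * s j)))
        else 0)" if "n i \<noteq> 0" for i
    proof (rule less.hyps)
      show "sum (n1 i) I < sum n I"
        using n1_sum[OF that, of "\<lambda>_. 1"] by simp
      show "sum (n1 i) I = k' + i + (\<Sum>j\<in>I. j * n1 i j)"
        using n1_sum[OF that, of "\<lambda>_. 1"] n1_sum[OF that, of "\<lambda>j. j"] less.prems(2) Suc by simp
    qed (fact n1_supp)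
    have s_sum: "(\<Sum>i\<in>I. s i) = 1 + (\<Sum>i\<in>I. i * s i)" if "\<forall>i. s i \<le> n i"
      unfolding s_def
    proof (rule tree_deg_stat_balance[OF I(1)])
      fix i assume "tree_deg_stat S i \<noteq> 0"
      then have "n i \<noteq> 0" using that[rule_format, of i] by (auto simp: s_def)
      then show "i \<in> I" by (rule less.prems(1))
    qed
    have n2_sum: "(\<Sum>i\<in>I. g i * n2 i) + (\<Sum>i\<in>I. g i * s i) = (\<Sum>i\<in>I. g i * n i)"
      if "\<forall>i. s i \<le> n i" for g :: "nat \<Rightarrow> nat"
      unfolding sum.distrib[symmetric] distrib_left[symmetric] n2_def using that by simp
    have IH2: "real (forest_moment S (r - 1) n2 k') =
       (if \<forall>j. (r - 1) * s j \<le> n2 j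
        then forest_weight k' ((r - 1) + (\<Sum>j\<in>I. n2 j - (r - 1) * s j)) / (fact (r - 1) * (\<Prod>j\<in>I. fact (n2 j - (r - 1) * s j)))
        else 0)" if "\<forall>i. s i \<le> n i"
    proof (rule less.hyps)
      show "sum n2 I < sum n I"
        using n2_sum[OF that, of "\<lambda>_. 1"] s_sum[OF that] by simp
      show "sum n2 I = k' + (\<Sum>j\<in>I. j * n2 j)"
        using n2_sum[OF that, of "\<lambda>_. 1"] n2_sum[OF that, of "\<lambda>j. j"] s_sum[OF that] less.prems(2) Suc by simp
    qed (use less.prems(1) in \<open>auto simp: n2_def\<close>)
    have rec: "real (forest_moment S r n k) = (\<Sum>i | n i \<noteq> 0. real (forest_moment S r (n1 i) (k' + i))) +
       (if r > 0 \<and> (\<forall>i. s i \<le> n i) then real (forest_moment S (r - 1) n2 k') else 0)"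
      unfolding Suc forest_moment_Suc[OF finn] by (simp add: s_def n1_def n2_def)
    show ?thesis
    proof (cases "\<forall>i. r * s i \<le> n i")
      case False
      then obtain j where j: "n j < r * s j" by (auto simp: not_le)
      have "real (forest_moment S r (n1 i) (k' + i)) = 0" if "n i \<noteq> 0" for i
      proof -
        have "n1 i j \<le> n j" by (simp add: n1_def)
        then have "\<not> (\<forall>j. r * s j \<le> n1 i j)"
          using j by (meson not_le order_le_less_trans)
        then show ?thesis by (simp only: IH1[OF that] if_False)
      qed
      moreover have "real (forest_moment S (r - 1) n2 k') = 0" if "r > 0" "\<forall>i. s i \<le> n i"
      proof -
        have "n2 j + s j = n j" using that by (simp add: n2_def)
        moreover have "(r - 1) * s j + s j = r * s j" using that by (cases r) simp_all
        ultimately have "\<not> (r - 1) * s j \<le> n2 j" using j by linarith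
        then have "\<not> (\<forall>j. (r - 1) * s j \<le> n2 j)" by blast
        then show ?thesis by (simp only: IH2[OF that(2)] if_False)
      qed
      ultimately show ?thesis unfolding if_not_P[OF False] rec by simp
    next
      case True
      define c where "c i = n i - r * s i" for i
      define t where "t = r + (\<Sum>i\<in>I. c i)"
      define P where "P = (\<Prod>i\<in>I. fact (c i) :: real)"
      have "P > 0" unfolding P_def by (intro prod_pos) auto
      have rs: "r > 0 \<Longrightarrow> \<forall>i. s i \<le> n i"
        using True by (metis Suc_leI le_trans mult_le_mono1 mult_1 One_nat_def)
      \<comment> \<open>Contracting a copy of \<open>S\<close> to a leaf removes as many vertices as edges.\<close>
      have t_bal: "t = k + (\<Sum>i\<in>I. i * c i)"
      proof -
        have *: "(\<Sum>i\<in>I. g i * c i) + r * (\<Sum>i\<in>I. g i * s i) = (\<Sum>i\<in>I. g i * n i)" for g :: "nat \<Rightarrow> nat"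
          unfolding sum_distrib_left sum.distrib[symmetric] c_def using True
          by (intro sum.cong) (auto simp: algebra_simps simp flip: distrib_left)
        show ?thesis
        proof (cases "r = 0")
          case False
          then have "(\<Sum>i\<in>I. s i) = 1 + (\<Sum>i\<in>I. i * s i)" by (intro s_sum rs) auto
          then show ?thesis
            using *[of "\<lambda>_. 1"] *[of "\<lambda>i. i"] less.prems(2) by (simp add: t_def algebra_simps)
        qed (use less.prems(2) in \<open>simp add: t_def c_def\<close>)
      qed
      have term1: "real (forest_moment S r (n1 i) (k' + i)) =
          real (c i) * forest_weight (k' + i) (t - 1) / (fact r * P)" if "n i \<noteq> 0" for i
      proof (cases "c i = 0")
        case True
        then have "\<not> (\<forall>j. r * s j \<le> n1 i j)"
          using that by (auto simp: c_def n1_def not_le intro!: exI[of _ i])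
        then have "real (forest_moment S r (n1 i) (k' + i)) = 0"
          by (simp only: IH1[OF that] if_False)
        then show ?thesis using True by simp
      next
        case False
        have "i \<in> I" using that less.prems(1) by auto
        have le: "\<forall>j. r * s j \<le> n1 i j"
          using True False by (auto simp: n1_def c_def)
        have c1: "n1 i j - r * s j = (c(i := c i - 1)) j" for j
          by (simp add: n1_def c_def)
        have "(\<Sum>j\<in>I. c j) = c i + (\<Sum>j\<in>I - {i}. c j)"
          using \<open>i \<in> I\<close> I(1) by (simp add: sum.remove)
        moreover have "(\<Sum>j\<in>I. (c(i := c i - 1)) j) = c i - 1 + (\<Sum>j\<in>I - {i}. c j)"
          using \<open>i \<in> I\<close> I(1) by (subst sum.remove[of _ i]) (auto intro!: sum.cong)
        ultimately have sumc: "r + (\<Sum>j\<in>I. (c(i := c i - 1)) j) = t - 1"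
          using False by (simp add: t_def)
        have "P = fact (c i) * (\<Prod>j\<in>I - {i}. fact (c j))"
          unfolding P_def using \<open>i \<in> I\<close> I(1) by (simp add: prod.remove)
        moreover have "(\<Prod>j\<in>I. fact ((c(i := c i - 1)) j)) = fact (c i - 1) * (\<Prod>j\<in>I - {i}. fact (c j) :: real)"
          using \<open>i \<in> I\<close> I(1) by (subst prod.remove[of _ i]) (auto intro!: prod.cong)
        moreover have "fact (c i) = real (c i) * fact (c i - 1)"
          using False by (simp add: fact_reduce)
        ultimately have "P = real (c i) * (\<Prod>j\<in>I. fact ((c(i := c i - 1)) j))"
          by simp
        then show ?thesis
          using False \<open>P > 0\<close> unfolding IH1[OF that] if_P[OF le] c1 sumc by (simp add: field_simps)
      qed
      have term2: "real (forest_moment S (r - 1) n2 k') = real r * forest_weight k' (t - 1) / (fact r * P)"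
        if "r > 0"
      proof -
        have le: "\<forall>j. (r - 1) * s j \<le> n2 j"
        proof
          fix j
          have "n2 j + s j = n j" using rs[OF that] by (simp add: n2_def)
          moreover have "(r - 1) * s j + s j = r * s j" using that by (cases r) simp_all
          moreover have "r * s j \<le> n j" using True by blast
          ultimately show "(r - 1) * s j \<le> n2 j" by linarith
        qed
        have c2: "n2 j - (r - 1) * s j = c j" for j
          using that by (cases r) (auto simp: n2_def c_def)
        have "fact r = real r * fact (r - 1)" using that by (simp add: fact_reduce)
        moreover have "r - 1 + (\<Sum>j\<in>I. c j) = t - 1" using that by (simp add: t_def)
        ultimately show ?thesis
          using that \<open>P > 0\<close> unfolding IH2[OF rs[OF that]] if_P[OF le] c2 P_def[symmetric] 
          by (simp add: field_simps)
      qed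
      have "real (forest_moment S r n k) = 
          ((\<Sum>i | n i \<noteq> 0. real (c i) * forest_weight (k' + i) (t - 1)) + real r * forest_weight k' (t - 1)) / (fact r * P)"
        unfolding rec using rs term2 by (auto simp: term1 sum_divide_distrib add_divide_distrib)
      also have "(\<Sum>i | n i \<noteq> 0. real (c i) * forest_weight (k' + i) (t - 1)) =
          (\<Sum>i\<in>I. real (c i) * forest_weight (k' + i) (t - 1))"
        using less.prems(1) I(1) by (intro sum.mono_neutral_left) (auto simp: c_def)
      also have "(\<Sum>i\<in>I. real (c i) * forest_weight (k' + i) (t - 1)) + real r * forest_weight k' (t - 1) = forest_weight k t"
      proof (cases "t = 1")
        case True
        then have "k = 1" using t_bal Suc by simp
        have "(\<Sum>i\<in>I. real (c i)) + real r = real t"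
          by (simp add: t_def)
        then show ?thesis using True \<open>k = 1\<close> by (simp add: forest_weight_def)
      next
        case False
        then have "t \<ge> 2" using t_bal Suc by linarith
        have rt: "real t = real k + real (\<Sum>i\<in>I. i * c i)" "real k = real k' + 1"
          using t_bal Suc \<open>t \<ge> 2\<close> by (simp_all only: of_nat_add of_nat_Suc) 
        have rt3: "real (t - 1) = real t - 1" using \<open>t \<ge> 2\<close> by (simp add: of_nat_diff)
        have "(\<Sum>i\<in>I. real (c i) * forest_weight (k' + i) (t - 1)) + real r * forest_weight k' (t - 1) =
          fact (t - 2) * ((\<Sum>i\<in>I. real (c i) * (real k' + real i)) + real r * real k')"
          using \<open>t \<ge> 2\<close> by (simp add: forest_weight_def numeral_2_eq_2 algebra_simps sum_distrib_left sum.distrib)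
        also have "(\<Sum>i\<in>I. real (c i) * (real k' + real i)) + real r * real k' = 
           real (k' * t + (\<Sum>i\<in>I. i * c i))"
          by (simp add: t_def algebra_simps sum_distrib_left sum.distrib)
        also have "\<dots> = real k * real (t - 1)"
          unfolding rt3 of_nat_add of_nat_mult
          using rt(1,2) by (simp add: algebra_simps)
        also have "fact (t - 2) * (real k * real (t - 1)) = forest_weight k t"
          using \<open>t \<ge> 2\<close> fact_reduce[of "t - 1", where 'a = real] by (simp add: forest_weight_def numeral_2_eq_2)
        finally show ?thesis .
      qed
      finally show ?thesis unfolding if_P[OF True] t_def c_def P_def .
    qed
  qed
qed

section \<open>Moments and weak convergence\<close>

lemma real_distribution_law: "real_distribution (law P X)"
  unfolding law_def by (intro prob_space.real_distribution_distr measure_pmf.prob_space_axioms) simp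

lemma integral_law: "(LINT x|law P X. x ^ j) = measure_pmf.expectation P (\<lambda>w. X w ^ j)"
  unfolding law_def by (subst integral_distr) auto

lemma integrable_law: "integrable (law P X) (\<lambda>x. x ^ j) \<longleftrightarrow> integrable (measure_pmf P) (\<lambda>w. X w ^ j)"
  unfolding law_def by (subst integrable_distr_eq) auto

text \<open>
  Taylor's formula for the characteristic function, with a remainder controlled by an even moment,
  compares both characteristic functions with polynomials in \<open>t\<close> whose coefficients are the moments.
  The remainder for the approximating measures converges to the one for the limit, which is small
  for large order by the growth condition.
\<close>

lemma method_of_moments:
  assumes M: "\<And>k. real_distribution (M k)" and N: "real_distribution N"
    and int_M: "\<forall>\<^sub>F k in sequentially. \<forall>j. integrable (M k) (\<lambda>x. x ^ j)"
    and int_N: "\<And>j. integrable N (\<lambda>x. x ^ j)"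
    and lim: "\<And>j. (\<lambda>k. LINT x|M k. x ^ j) \<longlonglongrightarrow> (LINT x|N. x ^ j)"
    and growth: "\<And>t. (\<lambda>j. t ^ (2 * j) / fact (2 * j) * (LINT x|N. x ^ (2 * j))) \<longlonglongrightarrow> 0"
  shows "weak_conv_m M N"
proof (rule levy_continuity[OF M N])
  fix t :: real
  define P where "P L j = (\<Sum>l\<le>2*j. (\<i> * complex_of_real t) ^ l / fact l * complex_of_real (LINT x|L. x ^ l))" for L j
  define B where "B L j = 2 * (t ^ (2 * j) / fact (2 * j) * (LINT x|L. x ^ (2 * j)))" for L j
  have approx: "cmod (char L t - P L j) \<le> B L j"
    if L: "real_distribution L" and int: "\<forall>j. integrable L (\<lambda>x. x ^ j)" for L j
    using real_distribution.char_approx1[OF L, of "2 * j" t] int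
    unfolding P_def B_def by (simp add: power_even_abs)
  have limP: "(\<lambda>k. P (M k) j) \<longlonglongrightarrow> P N j" for j
    unfolding P_def by (intro tendsto_sum tendsto_mult tendsto_const tendsto_of_real lim)
  have limB: "(\<lambda>k. B (M k) j) \<longlonglongrightarrow> B N j" for j
    unfolding B_def by (intro tendsto_mult tendsto_const lim)
  show "(\<lambda>k. char (M k) t) \<longlonglongrightarrow> char N t"
  proof (rule tendstoI)
    fix e :: real assume e: "e > 0"
    have "(\<lambda>j. B N j) \<longlonglongrightarrow> 2 * 0"
      unfolding B_def by (intro tendsto_mult tendsto_const growth)
    then obtain j where j: "B N j < e / 4"
      using e order_tendstoD(2)[of "\<lambda>j. B N j" 0 sequentially "e / 4"]
      by (auto simp: eventually_sequentially)
    have "\<forall>\<^sub>F k in sequentially. dist (P (M k) j) (P N j) < e / 4"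
      using e limP by (intro tendstoD) auto
    moreover have "\<forall>\<^sub>F k in sequentially. B (M k) j < e / 4"
      using limB j by (rule order_tendstoD)
    ultimately show "\<forall>\<^sub>F k in sequentially. dist (char (M k) t) (char N t) < e"
      using int_M
    proof eventually_elim
      case (elim k)
      have "cmod (char (M k) t - P (M k) j) \<le> B (M k) j"
        using elim by (intro approx M) auto
      moreover have "cmod (char N t - P N j) \<le> B N j"
        using int_N by (intro approx N) auto
      moreover have "cmod (char (M k) t - char N t) \<le>
          cmod (char (M k) t - P (M k) j) + cmod (P (M k) j - P N j) + cmod (char N t - P N j)"
        using norm_triangle_ineq4[of "char (M k) t - P (M k) j + (P (M k) j - P N j)" "char N t - P N j"]
          norm_triangle_ineq[of "char (M k) t - P (M k) j" "P (M k) j - P N j"] by simp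
      ultimately show ?case
        using elim j e unfolding dist_norm by linarith
    qed
  qed
qed

text \<open>
  The falling factorial \<open>x (x - 1) \<dots> (x - r + 1)\<close>. It is taken in a ring because arguments like
  \<open>N - 1 - r (m - 1)\<close> may be negative.
\<close>

definition ffall :: "'a::comm_ring_1 \<Rightarrow> nat \<Rightarrow> 'a" where
  "ffall x r = (\<Prod>j<r. x - of_nat j)"

lemma ffall_0 [simp]: "ffall x 0 = 1"
  by (simp add: ffall_def)

lemma ffall_Suc: "ffall x (Suc r) = ffall x r * (x - of_nat r)"
  by (simp add: ffall_def)

lemma ffall_add: "ffall x (a + b) = ffall x a * ffall (x - of_nat a) b"
  by (induction b) (simp_all add: ffall_Suc algebra_simps)

lemma ffall_choose: "ffall (real a) r = fact r * real (a choose r)"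
  by (simp add: ffall_def binomial_gbinomial gbinomial_prod_rev lessThan_atLeast0)

lemma ffall_fact:
  assumes "r \<le> a"
  shows "ffall (real a) r = fact a / fact (a - r)"
  using assms by (simp add: ffall_choose binomial_fact)

lemma ffall_eq_0: "a < r \<Longrightarrow> ffall (real a) r = 0"
  by (simp add: ffall_choose)

lemma integrable_Po_exp: "r \<ge> 0 \<Longrightarrow> integrable (measure_pmf (Po r)) (\<lambda>x. exp (t * real x))"
proof (cases "r = 0")
  case True
  then show ?thesis by (simp add: Po_def integrable_measure_pmf_finite)
next
  case False
  assume "r \<ge> 0"
  with False have r: "r > 0" by simp
  have "integrable (count_space UNIV) (\<lambda>x. pmf (poisson_pmf r) x * exp (t * real x))"
  proof (subst integrable_count_space_nat_iff)
    have "summable (\<lambda>x. exp (-r) * ((r * exp t) ^ x /\<^sub>R fact x))"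
      by (intro summable_mult summable_exp_generic)
    then show "summable (\<lambda>x. norm (pmf (poisson_pmf r) x * exp (t * real x)))"
      by (rule summable_cong[THEN iffD1, rotated])
        (use r in \<open>auto simp: field_simps power_mult_distrib abs_mult simp flip: exp_of_nat_mult\<close>)
  qed
  then show ?thesis using False
    by (simp add: Po_def integrable_density measure_pmf_eq_density)
qed

lemma power_le_fact_exp: "x \<ge> 0 \<Longrightarrow> x ^ j \<le> fact j * exp (x::real)"
  using exp_ge_add_one_self[of x] sum_le_suminf[OF summable_exp[of x], of "{j}"]
  by (simp add: exp_def field_simps)

lemma integrable_Po_power:
  assumes "r \<ge> 0"
  shows "integrable (measure_pmf (Po r)) (\<lambda>x. real x ^ j)"
proof (rule Bochner_Integration.integrable_bound)
  show "integrable (measure_pmf (Po r)) (\<lambda>x. fact j * exp (1 * real x))"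
    using assms by (intro integrable_mult_right integrable_Po_exp)
  show "AE x in measure_pmf (Po r). norm (real x ^ j) \<le> norm (fact j * exp (1 * real x))"
    using power_le_fact_exp[of "real _" j] by (intro AE_I2) (simp add: abs_mult)
qed simp

lemma Po_growth:
  assumes r: "r \<ge> 0"
  shows "(\<lambda>j. t ^ (2 * j) / fact (2 * j) * measure_pmf.expectation (Po r) (\<lambda>x. real x ^ (2 * j))) \<longlonglongrightarrow> 0"
proof -
  have pt: "(\<lambda>j. z ^ (2 * j) / fact (2 * j)) \<longlonglongrightarrow> 0" for z :: real
    using summable_LIMSEQ_zero[OF summable_exp[of z], THEN LIMSEQ_subseq_LIMSEQ, of "\<lambda>j. 2 * j"]
    by (simp add: o_def divide_inverse strict_mono_def mult.commute)
  have "(\<lambda>j. measure_pmf.expectation (Po r) (\<lambda>x. (t * real x) ^ (2 * j) / fact (2 * j))) \<longlonglongrightarrow>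
      measure_pmf.expectation (Po r) (\<lambda>x. 0)"
  proof (rule integral_dominated_convergence[where w = "\<lambda>x. exp (\<bar>t\<bar> * real x)"])
    show "AE x in measure_pmf (Po r). norm ((t * real x) ^ (2 * j) / fact (2 * j)) \<le> exp (\<bar>t\<bar> * real x)" for j
      using power_le_fact_exp[of "\<bar>t * real _\<bar>" "2 * j"]
      by (intro AE_I2) (simp add: power_abs abs_mult field_simps)
  qed (use r in \<open>auto intro!: integrable_Po_exp pt\<close>)
  then show ?thesis by (simp add: power_mult_distrib)
qed

lemma integrable_Po_ffall_power:
  assumes "r \<ge> 0"
  shows "integrable (measure_pmf (Po r)) (\<lambda>x. ffall (real x) l * real x ^ j)"
proof (induction l arbitrary: j)
  case (Suc l)
  have "integrable (measure_pmf (Po r)) (\<lambda>x. ffall (real x) l * real x ^ Suc j - real l * (ffall (real x) l * real x ^ j))"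
    using Suc by (intro Bochner_Integration.integrable_diff integrable_mult_right)
  then show ?case by (simp add: ffall_Suc algebra_simps)
qed (use assms in \<open>simp add: integrable_Po_power\<close>)

text \<open>
  Shifting the series by \<open>l\<close> cancels the falling factorial against the factorial in the Poisson
  weights.
\<close>

lemma expectation_Po_ffall:
  assumes "r \<ge> 0"
  shows "measure_pmf.expectation (Po r) (\<lambda>x. ffall (real x) l) = r ^ l"
proof (cases "r = 0")
  case True
  then show ?thesis using ffall_eq_0[of 0 l] by (cases l) (simp_all add: Po_def)
next
  case False
  with assms have r: "r > 0" by simp
  define h where "h x = pmf (poisson_pmf r) x * ffall (real x) l" for x
  have int: "integrable (count_space UNIV) h"
    using integrable_Po_ffall_power[of r l 0] assms False
    by (simp add: Po_def h_def[abs_def] integrable_density measure_pmf_eq_density)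
  have hl: "h (x + l) = exp (-r) * r ^ l * (r ^ x /\<^sub>R fact x)" for x
    using r ffall_fact[of l "x + l"] by (simp add: h_def power_add field_simps del: of_nat_add)
  have h0: "h x = 0" if "x < l" for x
    using that by (simp add: h_def ffall_eq_0)
  have "measure_pmf.expectation (Po r) (\<lambda>x. ffall (real x) l) = (\<integral>x. h x \<partial>count_space UNIV)"
    using False by (simp add: Po_def h_def integral_density measure_pmf_eq_density)
  also have "(\<integral>x. h x \<partial>count_space UNIV) = exp (-r) * r ^ l * exp r"
  proof (rule sums_unique2)
    have "h sums (\<integral>x. h x \<partial>count_space UNIV)"
      using int by (rule sums_integral_count_space_nat)
    then show "(\<lambda>x. h (x + l)) sums (\<integral>x. h x \<partial>count_space UNIV)"
      using sums_iff_shift[of h l "(\<integral>x. h x \<partial>count_space UNIV)"] by (simp add: h0)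
    show "(\<lambda>x. h (x + l)) sums (exp (-r) * r ^ l * exp r)"
      unfolding hl by (intro sums_mult exp_converges)
  qed
  finally show ?thesis by (simp add: exp_minus)
qed

definition fmoment :: "'a pmf \<Rightarrow> ('a \<Rightarrow> nat) \<Rightarrow> nat \<Rightarrow> real" where
  "fmoment P X r = measure_pmf.expectation P (\<lambda>w. ffall (real (X w)) r)"

text \<open>
  From \<open>(x)\<^sub>l x ^ (j + 1) = (x)\<^sub>l\<^sub>+\<^sub>1 x ^ j + l (x)\<^sub>l x ^ j\<close>, convergence passes from the mixed moments of order
  \<open>j\<close>, for all \<open>l\<close>, to those of order \<open>j + 1\<close>.
\<close>

lemma poisson_moments:
  assumes fin: "\<forall>\<^sub>F k in sequentially. finite (set_pmf (P k))"
    and r: "r \<ge> 0"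
    and lim: "\<And>l. (\<lambda>k. fmoment (P k) (X k) l) \<longlonglongrightarrow> r ^ l"
  shows "(\<lambda>k. measure_pmf.expectation (P k) (\<lambda>w. real (X k w) ^ j))
     \<longlonglongrightarrow> measure_pmf.expectation (Po r) (\<lambda>x. real x ^ j)"
proof -
  have "(\<lambda>k. measure_pmf.expectation (P k) (\<lambda>w. ffall (real (X k w)) l * real (X k w) ^ j))
     \<longlonglongrightarrow> measure_pmf.expectation (Po r) (\<lambda>x. ffall (real x) l * real x ^ j)" for l
  proof (induction j arbitrary: l)
    case 0
    then show ?case using lim[of l] r by (simp add: fmoment_def expectation_Po_ffall)
  next
    case (Suc j)
    have step: "ffall x l * x ^ Suc j = ffall x (Suc l) * x ^ j + real l * (ffall x l * x ^ j)" for x :: real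
      by (simp add: ffall_Suc algebra_simps)
    have Po: "measure_pmf.expectation (Po r) (\<lambda>x. ffall (real x) l * real x ^ Suc j) =
       measure_pmf.expectation (Po r) (\<lambda>x. ffall (real x) (Suc l) * real x ^ j) +
       real l * measure_pmf.expectation (Po r) (\<lambda>x. ffall (real x) l * real x ^ j)"
      unfolding step using integrable_Po_ffall_power[OF r]
      by (subst Bochner_Integration.integral_add) auto
    have *: "\<forall>\<^sub>F k in sequentially. 
       measure_pmf.expectation (P k) (\<lambda>w. ffall (real (X k w)) (Suc l) * real (X k w) ^ j) +
       real l * measure_pmf.expectation (P k) (\<lambda>w. ffall (real (X k w)) l * real (X k w) ^ j) =
       measure_pmf.expectation (P k) (\<lambda>w. ffall (real (X k w)) l * real (X k w) ^ Suc j)"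
      using fin
    proof eventually_elim
      case (elim k)
      then show ?case unfolding step
        by (subst Bochner_Integration.integral_add) (auto intro: integrable_measure_pmf_finite)
    qed
    show ?case unfolding Po
      by (rule Lim_transform_eventually[OF _ *]) (intro tendsto_add tendsto_mult tendsto_const Suc.IH)
  qed
  from this[of 0] show ?thesis by simp
qed

lemma poisson_weak_conv:
  assumes fin: "\<forall>\<^sub>F k in sequentially. finite (set_pmf (P k))"
    and r: "r \<ge> 0"
    and lim: "\<And>l. (\<lambda>k. fmoment (P k) (X k) l) \<longlonglongrightarrow> r ^ l"
  shows "weak_conv_m (\<lambda>k. law (P k) (\<lambda>w. real (X k w))) (law (Po r) real)"
proof (rule method_of_moments)
  show "\<forall>\<^sub>F k in sequentially. \<forall>j. integrable (law (P k) (\<lambda>w. real (X k w))) (\<lambda>x. x ^ j)"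
    using fin by eventually_elim (auto simp: integrable_law intro: integrable_measure_pmf_finite)
  show "(\<lambda>j. t ^ (2 * j) / fact (2 * j) * (LINT x|law (Po r) real. x ^ (2 * j))) \<longlonglongrightarrow> 0" for t
    unfolding integral_law by (rule Po_growth[OF r])
qed (use assms in \<open>auto simp: real_distribution_law integral_law integrable_law integrable_Po_power
  intro: poisson_moments\<close>)

section \<open>Finite differences and the Gaussian moment recursion\<close>

definition fdiff :: "(nat \<Rightarrow> 'a::comm_ring_1) \<Rightarrow> nat \<Rightarrow> 'a" where
  "fdiff h r = h (Suc r) - h r"

lemma fdiff_Suc: "(fdiff ^^ Suc a) h r = (fdiff ^^ a) h (Suc r) - (fdiff ^^ a) h r"
  by (simp add: fdiff_def)

lemma fdiff_shift: "(fdiff ^^ a) (\<lambda>r. h (Suc r)) r = (fdiff ^^ a) h (Suc r)"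
  by (induction a arbitrary: r) (simp_all add: fdiff_def)

lemma fdiff_add: "(fdiff ^^ a) (\<lambda>r. f r + g r) r = (fdiff ^^ a) f r + (fdiff ^^ a) g r"
  by (induction a arbitrary: r) (simp_all add: fdiff_def)

lemma fdiff_cmult: "(fdiff ^^ a) (\<lambda>r. c * f r) r = c * (fdiff ^^ a) f r"
  by (induction a arbitrary: r) (simp_all add: fdiff_def algebra_simps)

lemma fdiff_sum: "(fdiff ^^ a) (\<lambda>r. \<Sum>i\<in>A. f i r) r = (\<Sum>i\<in>A. (fdiff ^^ a) (f i) r)"
  by (induction a arbitrary: r) (simp_all add: fdiff_def sum_subtractf)

lemma fdiff_mult: "fdiff (\<lambda>r. f r * g r) = (\<lambda>r. fdiff f r * g r + f (Suc r) * fdiff g r)"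
  by (simp add: fdiff_def fun_eq_iff algebra_simps)

text \<open>
  A scale of smallness: a sequence of functions has order \<open>c\<close> if its \<open>b\<close>-th differences are of size
  \<open>\<sigma> ^ (- b - c)\<close>. The discrete product rule makes orders additive. One factor is only bounded on its
  scale, the other is negligible on its scale.
\<close>

lemma fdiff_mult_tendsto_0:
  fixes \<sigma> :: "nat \<Rightarrow> real"
  assumes "\<And>b r. b \<le> a \<Longrightarrow> (\<lambda>k. \<sigma> k ^ (b + c) * (fdiff ^^ b) (f k) r) \<longlonglongrightarrow> 0"
    and "\<And>b r. b \<le> a \<Longrightarrow> (\<lambda>k. \<sigma> k ^ (b + d) * (fdiff ^^ b) (g k) r) \<longlonglongrightarrow> G b r"
  shows "(\<lambda>k. \<sigma> k ^ (a + c + d) * (fdiff ^^ a) (\<lambda>r. f k r * g k r) r) \<longlonglongrightarrow> 0"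
  using assms
proof (induction a arbitrary: f g c d G r)
  case 0
  have "(\<lambda>k. (\<sigma> k ^ (0 + c) * (fdiff ^^ 0) (f k) r) * (\<sigma> k ^ (0 + d) * (fdiff ^^ 0) (g k) r)) \<longlonglongrightarrow> 0 * G 0 r"
    by (intro tendsto_mult 0) auto
  then show ?case by (simp add: power_add mult_ac)
next
  case (Suc a)
  have 1: "(\<lambda>k. \<sigma> k ^ (a + (c + 1) + d) * (fdiff ^^ a) (\<lambda>r. fdiff (f k) r * g k r) r) \<longlonglongrightarrow> 0"
  proof (rule Suc.IH[where G = G])
    show "(\<lambda>k. \<sigma> k ^ (b + (c + 1)) * (fdiff ^^ b) (fdiff (f k)) r) \<longlonglongrightarrow> 0" if "b \<le> a" for b r
      using Suc.prems(1)[of "Suc b" r] that by (simp add: funpow_swap1)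
    show "(\<lambda>k. \<sigma> k ^ (b + d) * (fdiff ^^ b) (g k) r) \<longlonglongrightarrow> G b r" if "b \<le> a" for b r
      using Suc.prems(2)[of b r] that by simp
  qed
  have 2: "(\<lambda>k. \<sigma> k ^ (a + c + (d + 1)) * (fdiff ^^ a) (\<lambda>r. f k (Suc r) * fdiff (g k) r) r) \<longlonglongrightarrow> 0"
  proof (rule Suc.IH)
    show "(\<lambda>k. \<sigma> k ^ (b + c) * (fdiff ^^ b) (\<lambda>r. f k (Suc r)) r) \<longlonglongrightarrow> 0" if "b \<le> a" for b r
      unfolding fdiff_shift using Suc.prems(1)[of b "Suc r"] that by simp
    show "(\<lambda>k. \<sigma> k ^ (b + (d + 1)) * (fdiff ^^ b) (fdiff (g k)) r) \<longlonglongrightarrow> G (Suc b) r" if "b \<le> a" for b r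
      using Suc.prems(2)[of "Suc b" r] that by (simp add: funpow_swap1)
  qed
  have "(fdiff ^^ Suc a) (\<lambda>r. f k r * g k r) r =
      (fdiff ^^ a) (\<lambda>r. fdiff (f k) r * g k r) r + (fdiff ^^ a) (\<lambda>r. f k (Suc r) * fdiff (g k) r) r" for k
    unfolding funpow_Suc_right o_def fdiff_mult by (rule fdiff_add)
  then show ?case
    using tendsto_add[OF 1 2] by (simp add: algebra_simps)
qed

text \<open>
  The function \<open>g\<close> is the discrete exponential \<open>\<Prod>l<r. 1 + \<eta> l\<close>. Its difference \<open>\<eta> g\<close> inherits the
  smallness of \<open>\<eta>\<close>, by induction on the order of the difference.
\<close>

lemma fdiff_exp_tendsto:
  fixes \<sigma> :: "nat \<Rightarrow> real"
  assumes \<sigma>: "filterlim \<sigma> at_top sequentially"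
    and g0: "\<And>k. g k 0 = 1"
    and rec: "\<forall>\<^sub>F k in sequentially. \<forall>r. fdiff (g k) r = \<eta> k r * g k r"
    and \<eta>: "\<And>b r. (\<lambda>k. \<sigma> k ^ (b + 1) * (fdiff ^^ b) (\<eta> k) r) \<longlonglongrightarrow> 0"
  shows "(\<lambda>k. \<sigma> k ^ a * (fdiff ^^ a) (g k) r) \<longlonglongrightarrow> of_bool (a = 0)"
proof (induction a arbitrary: r rule: less_induct)
  case (less a)
  show ?case
  proof (cases a)
    case 0
    have "(\<lambda>k. g k r) \<longlonglongrightarrow> 1"
    proof (induction r)
      case (Suc r)
      have "(\<lambda>k. inverse (\<sigma> k) * (\<sigma> k ^ (0 + 1) * (fdiff ^^ 0) (\<eta> k) r)) \<longlonglongrightarrow> 0 * 0"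
        by (intro tendsto_mult \<eta> tendsto_inverse_0_at_top[OF \<sigma>])
      then have "(\<lambda>k. inverse (\<sigma> k) * (\<sigma> k ^ (0 + 1) * (fdiff ^^ 0) (\<eta> k) r)) \<longlonglongrightarrow> 0"
        by (simp only: mult_zero_left)
      moreover have "\<forall>\<^sub>F k in sequentially. inverse (\<sigma> k) * (\<sigma> k ^ (0 + 1) * (fdiff ^^ 0) (\<eta> k) r) = \<eta> k r"
        using \<sigma>[unfolded filterlim_at_top_dense, rule_format, of 0] by eventually_elim simp
      ultimately have "(\<lambda>k. \<eta> k r) \<longlonglongrightarrow> 0"
        by (rule Lim_transform_eventually)
      then have "(\<lambda>k. (1 + \<eta> k r) * g k r) \<longlonglongrightarrow> (1 + 0) * 1"
        by (intro tendsto_intros Suc.IH)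
      then have "(\<lambda>k. (1 + \<eta> k r) * g k r) \<longlonglongrightarrow> 1"
        by (simp only: add_0_right mult_1_left)
      moreover have "\<forall>\<^sub>F k in sequentially. (1 + \<eta> k r) * g k r = g k (Suc r)"
        using rec by eventually_elim (auto simp: fdiff_def algebra_simps)
      ultimately show ?case
        by (rule Lim_transform_eventually)
    qed (simp add: g0)
    then show ?thesis by (simp add: 0)
  next
    case (Suc a')
    have "(\<lambda>k. \<sigma> k ^ (a' + 1 + 0) * (fdiff ^^ a') (\<lambda>r. \<eta> k r * g k r) r) \<longlonglongrightarrow> 0"
      using less.IH Suc by (intro fdiff_mult_tendsto_0[where G = "\<lambda>b r. of_bool (b = 0)"] \<eta>) simp
    moreover have "\<forall>\<^sub>F k in sequentially. \<sigma> k ^ (a' + 1 + 0) * (fdiff ^^ a') (\<lambda>r. \<eta> k r * g k r) r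
        = \<sigma> k ^ a * (fdiff ^^ a) (g k) r"
      using rec
    proof eventually_elim
      case (elim k)
      then have "fdiff (g k) = (\<lambda>r. \<eta> k r * g k r)" by auto
      then show ?case by (simp add: Suc funpow_Suc_right del: funpow.simps(2))
    qed
    ultimately have "(\<lambda>k. \<sigma> k ^ a * (fdiff ^^ a) (g k) r) \<longlonglongrightarrow> 0"
      by (rule Lim_transform_eventually)
    then show ?thesis by (simp add: Suc del: funpow.simps)
  qed
qed

text \<open>
  On the scale \<open>V k j \<sim> \<sigma> ^ j\<close> with differences in \<open>r\<close> smaller by \<open>\<sigma>\<close> each, the term
  \<open>\<sigma>\<^sup>2 fdiff (V k j)\<close> is of order \<open>\<sigma> ^ (j + 1)\<close> but its coefficient tends to \<open>0\<close>, being a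
  difference, and in the sum only \<open>l = j - 1\<close> has order \<open>\<sigma> ^ (j + 1)\<close>, with coefficient \<open>j\<close>. The
  differences have to be carried through the induction, which is why \<open>a\<close> is general.
\<close>

lemma gaussian_recursion_tendsto:
  fixes \<sigma> :: "nat \<Rightarrow> real" and V :: "nat \<Rightarrow> nat \<Rightarrow> nat \<Rightarrow> real"
  assumes \<sigma>: "filterlim \<sigma> at_top sequentially"
    and V0: "\<And>a r. (\<lambda>k. \<sigma> k ^ a * (fdiff ^^ a) (V k 0) r) \<longlonglongrightarrow> of_bool (a = 0)"
    and rec: "\<forall>\<^sub>F k in sequentially. \<forall>j r. V k (Suc j) r =
        \<sigma> k ^ 2 * fdiff (V k j) r + (\<Sum>l<j. \<sigma> k ^ 2 * (real (j choose l) * V k l (Suc r)))"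
    and G: "G 0 = 1" "\<And>j. G (Suc j) = real j * G (j - 1)"
  shows "(\<lambda>k. \<sigma> k ^ a / \<sigma> k ^ j * (fdiff ^^ a) (V k j) r) \<longlonglongrightarrow> of_bool (a = 0) * G j"
proof (induction j arbitrary: a r rule: less_induct)
  case (less j)
  have \<sigma>pos: "\<forall>\<^sub>F k in sequentially. \<sigma> k > 0"
    using \<sigma>[unfolded filterlim_at_top_dense] by blast
  show ?case
  proof (cases j)
    case 0
    then show ?thesis using V0[of a r] G by simp
  next
    case (Suc i)
    \<comment> \<open>The factor \<open>\<sigma>\<^sup>2\<close> is absorbed by one power of \<open>\<sigma>\<close> for the additional difference and one for \<open>j = i + 1\<close>.\<close>
    have main: "(\<lambda>k. \<sigma> k ^ Suc a / \<sigma> k ^ i * (fdiff ^^ Suc a) (V k i) r) \<longlonglongrightarrow> 0"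
      using less.IH[of i "Suc a" r] Suc by simp
    have inv0: "(\<lambda>k. inverse (\<sigma> k) ^ e) \<longlonglongrightarrow> of_bool (e = 0)" for e
      using tendsto_power[OF tendsto_inverse_0_at_top[OF \<sigma>], of e] by (cases e) auto
    have "(\<lambda>k. \<Sum>l<i. real (i choose l) * (inverse (\<sigma> k) ^ (i - 1 - l) * (\<sigma> k ^ a / \<sigma> k ^ l * (fdiff ^^ a) (V k l) (Suc r))))
        \<longlonglongrightarrow> (\<Sum>l<i. real (i choose l) * (of_bool (i - 1 - l = 0) * (of_bool (a = 0) * G l)))"
      using Suc by (intro tendsto_sum tendsto_mult[OF tendsto_const tendsto_mult[OF inv0 less.IH]]) auto
    also have "(\<Sum>l<i. real (i choose l) * (of_bool (i - 1 - l = 0) * (of_bool (a = 0) * G l))) = of_bool (a = 0) * G j"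
    proof (cases i)
      case (Suc i')
      have "(\<Sum>l<i. real (i choose l) * (of_bool (i - 1 - l = 0) * (of_bool (a = 0) * G l))) =
          (\<Sum>l\<in>{i'}. real (i choose l) * (of_bool (i - 1 - l = 0) * (of_bool (a = 0) * G l)))"
        unfolding Suc by (rule sum.mono_neutral_right) auto
      then show ?thesis using \<open>j = Suc i\<close> Suc G(2)[of i] by simp
    qed (use G(2)[of 0] Suc in simp)
    finally have rest: "(\<lambda>k. \<Sum>l<i. real (i choose l) * (inverse (\<sigma> k) ^ (i - 1 - l) * (\<sigma> k ^ a / \<sigma> k ^ l * (fdiff ^^ a) (V k l) (Suc r))))
        \<longlonglongrightarrow> of_bool (a = 0) * G j" .
    have "\<forall>\<^sub>F k in sequentially. \<sigma> k ^ Suc a / \<sigma> k ^ i * (fdiff ^^ Suc a) (V k i) r +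
        (\<Sum>l<i. real (i choose l) * (inverse (\<sigma> k) ^ (i - 1 - l) * (\<sigma> k ^ a / \<sigma> k ^ l * (fdiff ^^ a) (V k l) (Suc r))))
        = \<sigma> k ^ a / \<sigma> k ^ j * (fdiff ^^ a) (V k j) r"
      using rec \<sigma>pos
    proof eventually_elim
      case (elim k)
      have "V k j = (\<lambda>r. \<sigma> k ^ 2 * fdiff (V k i) r + (\<Sum>l<i. \<sigma> k ^ 2 * (real (i choose l) * V k l (Suc r))))"
        using elim Suc by auto
      then have "(fdiff ^^ a) (V k j) r = \<sigma> k ^ 2 * (fdiff ^^ Suc a) (V k i) r +
          (\<Sum>l<i. \<sigma> k ^ 2 * (real (i choose l) * (fdiff ^^ a) (V k l) (Suc r)))"
        by (simp only: fdiff_add fdiff_cmult fdiff_sum fdiff_shift funpow_Suc_right o_def)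
      moreover have "\<sigma> k ^ a / \<sigma> k ^ j * (\<sigma> k ^ 2 * (real (i choose l) * x)) =
          real (i choose l) * (inverse (\<sigma> k) ^ (i - 1 - l) * (\<sigma> k ^ a / \<sigma> k ^ l * x))" if "l < i" for l x
      proof -
        have "\<sigma> k ^ j = \<sigma> k ^ 2 * \<sigma> k ^ (i - 1 - l) * \<sigma> k ^ l"
          unfolding power_add[symmetric] using that Suc by (intro arg_cong[where f = "(^) (\<sigma> k)"]) simp
        then show ?thesis using elim(2) by (simp add: field_simps)
      qed
      moreover have "\<sigma> k ^ a / \<sigma> k ^ j * (\<sigma> k ^ 2 * x) = \<sigma> k ^ Suc a / \<sigma> k ^ i * x" for x
        using elim(2) Suc by (simp add: field_simps power2_eq_square)
      ultimately show ?case
        by (simp add: distrib_left sum_distrib_left del: funpow.simps)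
    qed
    from Lim_transform_eventually[OF tendsto_add[OF main rest] this] show ?thesis
      by simp
  qed
qed

lemma std_normal_moment_rec:
  "(LINT x|std_normal_distribution. x ^ Suc j) = real j * (LINT x|std_normal_distribution. x ^ (j - 1))"
proof (cases "even j")
  case True
  then show ?thesis
    using integral_std_normal_distribution_moment_odd[of "Suc j"] integral_std_normal_distribution_moment_odd[of "j - 1"]
    by (cases "j = 0") (auto simp del: power_Suc)
next
  case False
  then obtain i where j: "j = 2 * i + 1" by (elim oddE)
  have "(LINT x|std_normal_distribution. x ^ (2 * Suc i)) = (2 * real i + 1) * (LINT x|std_normal_distribution. x ^ (2 * i))"
  proof -
    have 1: "fact (2 * Suc i) = (2 * (1 + real i)) * ((2 * real i + 1) * fact (2 * i))"
      by (simp add: algebra_simps)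
    have 2: "2 ^ Suc i * fact (Suc i) = (2 * (1 + real i)) * (2 ^ i * fact i)"
      by simp
    show ?thesis
      unfolding std_normal_distribution_even_moments 1 2
      by (subst mult_divide_mult_cancel_left) simp_all
  qed
  then show ?thesis using j by simp
qed

lemma std_normal_growth:
  "(\<lambda>j. t ^ (2 * j) / fact (2 * j) * (LINT x|std_normal_distribution. x ^ (2 * j))) \<longlonglongrightarrow> 0"
proof -
  have "(\<lambda>j. (t\<^sup>2 / 2) ^ j /\<^sub>R fact j) \<longlonglongrightarrow> 0"
    by (rule summable_LIMSEQ_zero) (rule summable_exp_generic)
  moreover have "t ^ (2 * j) / fact (2 * j) * (fact (2 * j) / (2 ^ j * fact j)) = (t\<^sup>2 / 2) ^ j /\<^sub>R fact j" for j
    unfolding power_mult power_divide real_scaleR_def by (simp add: field_simps)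
  ultimately show ?thesis
    unfolding std_normal_distribution_even_moments by simp
qed

text \<open>
  With \<open>V k j r = E ((X)\<^sub>r (X - r - \<mu>) ^ j) / \<mu> ^ r\<close>, the factor \<open>(X)\<^sub>r (X - r)\<close> is \<open>(X)\<^sub>r\<^sub>+\<^sub>1\<close>, and expanding
  \<open>X - r - \<mu> = (X - (r + 1) - \<mu>) + 1\<close> expresses \<open>V k (j + 1) r\<close> by \<open>V k l (r + 1)\<close>, \<open>l \<le> j\<close>, and
  \<open>V k j r\<close>. This is the recursion of \<open>gaussian_recursion_tendsto\<close> with \<open>\<sigma> = sqrt \<mu>\<close>. The central
  moments are the values at \<open>r = 0\<close>.
\<close>

lemma normal_moments:
  fixes X :: "nat \<Rightarrow> 'a \<Rightarrow> nat" and \<mu> :: "nat \<Rightarrow> real"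
  assumes fin: "\<forall>\<^sub>F k in sequentially. finite (set_pmf (P k))"
    and \<mu>: "filterlim \<mu> at_top sequentially"
    and rec: "\<forall>\<^sub>F k in sequentially. \<forall>r. fmoment (P k) (X k) (Suc r) = \<mu> k * (1 + \<eta> k r) * fmoment (P k) (X k) r"
    and \<eta>: "\<And>b r. (\<lambda>k. sqrt (\<mu> k) ^ (b + 1) * (fdiff ^^ b) (\<eta> k) r) \<longlonglongrightarrow> 0"
  shows "(\<lambda>k. measure_pmf.expectation (P k) (\<lambda>w. ((real (X k w) - \<mu> k) / sqrt (\<mu> k)) ^ j))
     \<longlonglongrightarrow> (LINT x|std_normal_distribution. x ^ j)"
proof -
  define \<sigma> where "\<sigma> k = sqrt (\<mu> k)" for k
  define V where "V k j r = measure_pmf.expectation (P k) (\<lambda>w. ffall (real (X k w)) r * (real (X k w) - real r - \<mu> k) ^ j) / \<mu> k ^ r" for k j r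
  have \<sigma>: "filterlim \<sigma> at_top sequentially"
    unfolding \<sigma>_def using \<mu> by (rule filterlim_compose[OF sqrt_at_top])
  have \<mu>pos: "\<forall>\<^sub>F k in sequentially. \<mu> k > 0"
    using \<mu>[unfolded filterlim_at_top_dense] by blast
  have V0: "(\<lambda>k. \<sigma> k ^ a * (fdiff ^^ a) (V k 0) r) \<longlonglongrightarrow> of_bool (a = 0)" for a r
  proof (rule fdiff_exp_tendsto[OF \<sigma>])
    show "\<forall>\<^sub>F k in sequentially. \<forall>r. fdiff (V k 0) r = \<eta> k r * V k 0 r"
      using rec \<mu>pos
    proof eventually_elim
      case (elim k)
      have V0_eq: "V k 0 r = fmoment (P k) (X k) r / \<mu> k ^ r" for r
        by (simp add: V_def fmoment_def)
      have "V k 0 (Suc r) = (1 + \<eta> k r) * V k 0 r" for r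
        using elim(2) unfolding V0_eq elim(1)[rule_format] by simp
      then show ?case by (simp add: fdiff_def algebra_simps)
    qed
    show "(\<lambda>k. \<sigma> k ^ (b + 1) * (fdiff ^^ b) (\<eta> k) r) \<longlonglongrightarrow> 0" for b r
      unfolding \<sigma>_def by (rule \<eta>)
  qed (simp add: V_def)
  have "(\<lambda>k. \<sigma> k ^ 0 / \<sigma> k ^ j * (fdiff ^^ 0) (V k j) 0) \<longlonglongrightarrow> of_bool (0 = (0::nat)) * (LINT x|std_normal_distribution. x ^ j)"
  proof (rule gaussian_recursion_tendsto[where V = V])
    show "\<forall>\<^sub>F k in sequentially. \<forall>j r. V k (Suc j) r =
        \<sigma> k ^ 2 * fdiff (V k j) r + (\<Sum>l<j. \<sigma> k ^ 2 * (real (j choose l) * V k l (Suc r)))"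
      using \<mu>pos fin
    proof eventually_elim
      case (elim k)
      have int: "integrable (measure_pmf (P k)) f" for f :: "'a \<Rightarrow> real"
        using elim by (intro integrable_measure_pmf_finite)
      have \<sigma>2: "\<sigma> k ^ 2 = \<mu> k" using elim by (simp add: \<sigma>_def)
      have "V k (Suc j) r = \<sigma> k ^ 2 * fdiff (V k j) r + (\<Sum>l<j. \<sigma> k ^ 2 * (real (j choose l) * V k l (Suc r)))" for j r
      proof -
        have pt: "ffall x r * (x - real r - \<mu> k) ^ Suc j =
           (\<Sum>l\<le>j. real (j choose l) * (ffall x (Suc r) * (x - real (Suc r) - \<mu> k) ^ l)) -
           \<mu> k * (ffall x r * (x - real r - \<mu> k) ^ j)" for x
        proof -
          have "(x - real r - \<mu> k) ^ j = (x - real (Suc r) - \<mu> k + 1) ^ j"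
            by (rule arg_cong[where f = "\<lambda>y. y ^ j"]) simp
          also have "\<dots> = (\<Sum>l\<le>j. real (j choose l) * (x - real (Suc r) - \<mu> k) ^ l)"
            unfolding binomial_ring by simp
          finally have *: "(x - real r - \<mu> k) ^ j = (\<Sum>l\<le>j. real (j choose l) * (x - real (Suc r) - \<mu> k) ^ l)" .
          then have "(\<Sum>l\<le>j. real (j choose l) * (ffall x (Suc r) * (x - real (Suc r) - \<mu> k) ^ l)) =
             ffall x (Suc r) * (x - real r - \<mu> k) ^ j"
            unfolding * sum_distrib_left by (simp only: mult_ac)
          then show ?thesis by (simp add: ffall_Suc algebra_simps)
        qed
        have "measure_pmf.expectation (P k) (\<lambda>w. ffall (real (X k w)) r * (real (X k w) - real r - \<mu> k) ^ Suc j) =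
          (\<Sum>l\<le>j. real (j choose l) * measure_pmf.expectation (P k) (\<lambda>w. ffall (real (X k w)) (Suc r) * (real (X k w) - real (Suc r) - \<mu> k) ^ l)) -
           \<mu> k * measure_pmf.expectation (P k) (\<lambda>w. ffall (real (X k w)) r * (real (X k w) - real r - \<mu> k) ^ j)"
          unfolding pt by (simp only: Bochner_Integration.integral_diff[OF int int]
              Bochner_Integration.integral_sum[OF int] integral_mult_right_zero)
        then have "V k (Suc j) r = \<mu> k * (\<Sum>l\<le>j. real (j choose l) * V k l (Suc r)) - \<mu> k * V k j r"
          using elim(1) by (simp add: V_def diff_divide_distrib sum_distrib_left sum_divide_distrib)
        also have "(\<Sum>l\<le>j. real (j choose l) * V k l (Suc r)) = V k j (Suc r) + (\<Sum>l<j. real (j choose l) * V k l (Suc r))"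
          by (simp flip: lessThan_Suc_atMost)
        finally show ?thesis
          unfolding \<sigma>2 fdiff_def sum_distrib_left[symmetric] by (simp add: algebra_simps)
      qed
      then show ?case by blast
    qed
  qed (use \<sigma> V0 std_normal_distribution_even_moments(1)[of 0] in \<open>auto simp: std_normal_moment_rec simp del: power_Suc\<close>)
  then show ?thesis by (simp add: V_def \<sigma>_def power_divide)
qed

lemma normal_weak_conv:
  assumes fin: "\<forall>\<^sub>F k in sequentially. finite (set_pmf (P k))"
    and mom: "\<And>j. (\<lambda>k. measure_pmf.expectation (P k) (\<lambda>w. Y k w ^ j)) \<longlonglongrightarrow> (LINT x|std_normal_distribution. x ^ j)"
  shows "weak_conv_m (\<lambda>k. law (P k) (Y k)) std_normal_distribution"
proof (rule method_of_moments)
  show "\<forall>\<^sub>F k in sequentially. \<forall>j. integrable (law (P k) (Y k)) (\<lambda>x. x ^ j)"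
    using fin by eventually_elim (auto simp: integrable_law intro: integrable_measure_pmf_finite)
  show "(\<lambda>k. LINT x|law (P k) (Y k). x ^ j) \<longlonglongrightarrow> (LINT x|std_normal_distribution. x ^ j)" for j
    unfolding integral_law by (rule mom)
  show "(\<lambda>j. t ^ (2 * j) / fact (2 * j) * (LINT x|std_normal_distribution. x ^ (2 * j))) \<longlonglongrightarrow> 0" for t
    by (rule std_normal_growth)
qed (auto intro: real_distribution_law real_dist_normal_dist integrable_std_normal_distribution_moment)

section \<open>The ratio of consecutive factorial moments\<close>

text \<open>
  The value of the \<open>r\<close>-th factorial moment, \<open>I\<close> being any finite set containing the degrees in \<open>n\<close> and \<open>s\<close>.
  If \<open>r s \<le> n\<close> fails, the numerator vanishes.
\<close>

definition fact_moment :: "nat set \<Rightarrow> (nat \<Rightarrow> nat) \<Rightarrow> (nat \<Rightarrow> nat) \<Rightarrow> nat \<Rightarrow> real" where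
  "fact_moment I n s r =
     (\<Prod>i\<in>I. ffall (real (n i)) (r * s i)) / ffall (real (sum n I) - 1) (r * (sum s I - 1))"

definition param :: "nat set \<Rightarrow> (nat \<Rightarrow> nat) \<Rightarrow> (nat \<Rightarrow> nat) \<Rightarrow> real" where
  "param I n s = real (sum n I) * (\<Prod>i\<in>I. (real (n i) / real (sum n I)) ^ s i)"

definition moment_ratio :: "nat set \<Rightarrow> (nat \<Rightarrow> nat) \<Rightarrow> (nat \<Rightarrow> nat) \<Rightarrow> nat \<Rightarrow> real" where
  "moment_ratio I n s r =
     (\<Prod>i\<in>I. ffall (real (n i) - real (r * s i)) (s i)) /
     ffall (real (sum n I) - 1 - real (r * (sum s I - 1))) (sum s I - 1)"

text \<open>
  The quotient of \<open>moment_ratio\<close> and \<open>param\<close>, as a rational function of \<open>z = r\<close>.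
\<close>

definition rel_ratio :: "nat set \<Rightarrow> (nat \<Rightarrow> nat) \<Rightarrow> (nat \<Rightarrow> nat) \<Rightarrow> 'a::real_normed_field \<Rightarrow> 'a" where
  "rel_ratio I n s z =
     (\<Prod>i\<in>I. \<Prod>j<s i. 1 - (z * of_nat (s i) + of_nat j) / of_nat (n i)) /
     (\<Prod>j<sum s I - 1. 1 - (1 + z * of_nat (sum s I - 1) + of_nat j) / of_nat (sum n I))"

lemma fact_moment_Suc: "fact_moment I n s (Suc r) = moment_ratio I n s r * fact_moment I n s r"
proof -
  have *: "ffall x (Suc r * b) = ffall x (r * b) * ffall (x - real (r * b)) b" for x :: real and b
    using ffall_add[of x "r * b" b] by (simp add: add.commute)
  then show ?thesis
    unfolding fact_moment_def moment_ratio_def * prod.distrib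
    by (simp only: times_divide_times_eq mult.commute)
qed

lemma moment_ratio_eq:
  assumes "finite I" and s: "sum s I > 0" and n: "\<And>i. i \<in> I \<Longrightarrow> s i > 0 \<Longrightarrow> n i > 0"
  shows "moment_ratio I n s r = param I n s * rel_ratio I n s (real r)"
proof -
  define N m where "N = sum n I" and "m = sum s I"
  obtain i where "i \<in> I" "s i > 0"
    using s by (metis sum.neutral not_gr_zero less_irrefl)
  then have "N > 0"
    using n[of i] member_le_sum[of i I n] assms(1) unfolding N_def by simp
  have num: "(\<Prod>i\<in>I. ffall (real (n i) - real (r * s i)) (s i)) =
      (\<Prod>i\<in>I. real (n i) ^ s i) * (\<Prod>i\<in>I. \<Prod>j<s i. 1 - (real r * of_nat (s i) + of_nat j) / of_nat (n i))"
    unfolding prod.distrib[symmetric]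
  proof (intro prod.cong refl)
    fix i assume i: "i \<in> I"
    have "(\<Prod>j<s i. real (n i) - real (r * s i) - real j) =
        (\<Prod>j<s i. real (n i) * (1 - (real r * of_nat (s i) + of_nat j) / of_nat (n i)))"
      using n[OF i] by (intro prod.cong) (auto simp: field_simps)
    then show "ffall (real (n i) - real (r * s i)) (s i) =
        real (n i) ^ s i * (\<Prod>j<s i. 1 - (real r * of_nat (s i) + of_nat j) / of_nat (n i))"
      by (simp add: ffall_def prod.distrib)
  qed
  have "(\<Prod>j<m - 1. real N - 1 - real (r * (m - 1)) - real j) =
      (\<Prod>j<m - 1. real N * (1 - (1 + real r * of_nat (m - 1) + of_nat j) / of_nat N))"
    using \<open>N > 0\<close> by (intro prod.cong) (auto simp: field_simps)
  then have den: "ffall (real N - 1 - real (r * (m - 1))) (m - 1) =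
      real N ^ (m - 1) * (\<Prod>j<m - 1. 1 - (1 + real r * of_nat (m - 1) + of_nat j) / of_nat N)"
    by (simp add: ffall_def prod.distrib)
  have "(\<Prod>i\<in>I. (real (n i) / real N) ^ s i) = (\<Prod>i\<in>I. real (n i) ^ s i) / real N ^ m"
    by (simp add: power_divide prod_dividef m_def power_sum)
  also have "real N ^ m = real N * real N ^ (m - 1)"
    using s by (simp add: m_def flip: power_Suc)
  finally have "param I n s = (\<Prod>i\<in>I. real (n i) ^ s i) / real N ^ (m - 1)"
    using \<open>N > 0\<close> by (simp add: param_def N_def del: of_nat_sum)
  then show ?thesis
    unfolding moment_ratio_def rel_ratio_def num den[unfolded N_def m_def] by (simp add: N_def m_def)
qed

lemma rel_ratio_of_real: "rel_ratio I n s (of_real x) = of_real (rel_ratio I n s x)"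
  by (simp add: rel_ratio_def)

lemma norm_prod_1_minus_le:
  fixes x :: "'b \<Rightarrow> 'a::real_normed_field"
  assumes A: "finite A" and S: "(\<Sum>a\<in>A. norm (x a)) \<le> S"
  shows "norm ((\<Prod>a\<in>A. 1 + x a) - 1) \<le> exp S - 1"
proof -
  have "norm ((\<Prod>a\<in>A. 1 + x a) - 1) \<le> (\<Prod>a\<in>A. 1 + norm (x a)) - 1"
    using A
  proof (induction A)
    case (insert b A)
    define P Q where "P = (\<Prod>a\<in>A. 1 + x a)" and "Q = (\<Prod>a\<in>A. 1 + norm (x a))"
    have "norm (1 + x a) \<le> 1 + norm (x a)" for a
      using norm_triangle_ineq[of 1 "x a"] by simp
    then have "norm P \<le> Q"
      by (auto simp: P_def Q_def simp flip: prod_norm intro!: prod_mono)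
    have "norm ((1 + x b) * P - 1) = norm ((P - 1) + x b * P)" by (simp add: algebra_simps)
    also have "\<dots> \<le> norm (P - 1) + norm (x b) * norm P" by (metis norm_mult norm_triangle_ineq)
    also have "\<dots> \<le> (Q - 1) + norm (x b) * Q"
      using \<open>norm P \<le> Q\<close> insert.IH by (intro add_mono mult_left_mono) (auto simp: P_def Q_def)
    finally show ?case using insert.hyps by (simp add: P_def Q_def algebra_simps)
  qed simp
  also have "(\<Prod>a\<in>A. 1 + norm (x a)) \<le> (\<Prod>a\<in>A. exp (norm (x a)))"
    by (intro prod_mono) auto
  also have "\<dots> \<le> exp S" using A S by (simp flip: exp_sum)
  finally show ?thesis by simp
qed

text \<open>
  A factor \<open>1 / (1 - y)\<close> with \<open>norm y \<le> 1/3\<close> is \<open>1 + y / (1 - y)\<close>, at distance at most \<open>2 norm y\<close> from \<open>1\<close>;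
  so the product differs from \<open>1\<close> by at most \<open>exp (3 S) - 1\<close>.
\<close>

lemma norm_prod_quotient_minus_1_le:
  fixes x :: "'b \<Rightarrow> 'a::real_normed_field" and y :: "'c \<Rightarrow> 'a"
  assumes A: "finite A" "(\<Sum>a\<in>A. norm (x a)) \<le> S" and B: "finite B" "(\<Sum>b\<in>B. norm (y b)) \<le> S"
    and S: "S \<le> 1/3"
  shows "norm ((\<Prod>a\<in>A. 1 - x a) / (\<Prod>b\<in>B. 1 - y b) - 1) \<le> 6 * S"
    and "b \<in> B \<Longrightarrow> y b \<noteq> 1"
proof -
  have y: "norm (y b) \<le> 1/3" if "b \<in> B" for b
    using member_le_sum[of b B "\<lambda>b. norm (y b)"] that B S by simp
  then have y1: "y b \<noteq> 1" if "b \<in> B" for b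
    using that by force
  then show "b \<in> B \<Longrightarrow> y b \<noteq> 1" .
  define \<alpha> where "\<alpha> = (\<Prod>a\<in>A. 1 + - x a) - 1"
  define \<beta> where "\<beta> = (\<Prod>b\<in>B. 1 + y b / (1 - y b)) - 1"
  have S0: "S \<ge> 0" using A(2) by (meson norm_ge_zero order_trans sum_nonneg)
  have \<alpha>: "norm \<alpha> \<le> exp S - 1"
    unfolding \<alpha>_def by (intro norm_prod_1_minus_le A(1)) (use A(2) in simp)
  have "(\<Sum>b\<in>B. norm (y b / (1 - y b))) \<le> (\<Sum>b\<in>B. 2 * norm (y b))"
  proof (rule sum_mono)
    fix b assume b: "b \<in> B"
    have "1 - norm (y b) \<le> norm (1 - y b)"
      using norm_triangle_ineq2[of 1 "y b"] by simp
    then have "1/2 \<le> norm (1 - y b)" using y[OF b] by simp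
    then have "norm (y b) * 1 \<le> norm (y b) * (2 * norm (1 - y b))"
      by (intro mult_left_mono) auto
    then show "norm (y b / (1 - y b)) \<le> 2 * norm (y b)"
      using y1[OF b] by (simp add: norm_divide field_simps)
  qed
  also have "\<dots> \<le> 2 * S" using B(2) by (simp flip: sum_distrib_left)
  finally have \<beta>: "norm \<beta> \<le> exp (2 * S) - 1"
    unfolding \<beta>_def by (intro norm_prod_1_minus_le B(1))
  have "(\<Prod>b\<in>B. 1 + y b / (1 - y b)) = (\<Prod>b\<in>B. 1 / (1 - y b))"
    using y1 by (intro prod.cong) (auto simp: field_simps)
  then have "(\<Prod>a\<in>A. 1 - x a) / (\<Prod>b\<in>B. 1 - y b) = (1 + \<alpha>) * (1 + \<beta>)"
    by (simp add: \<alpha>_def \<beta>_def prod_dividef)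
  then have "norm ((\<Prod>a\<in>A. 1 - x a) / (\<Prod>b\<in>B. 1 - y b) - 1) = norm (\<alpha> + \<beta> + \<alpha> * \<beta>)"
    by (simp add: algebra_simps)
  also have "\<dots> \<le> norm \<alpha> + norm \<beta> + norm \<alpha> * norm \<beta>"
    by (metis norm_triangle_ineq norm_mult norm_triangle_le add_mono order_refl)
  also have "\<dots> \<le> (exp S - 1) + (exp (2 * S) - 1) + (exp S - 1) * (exp (2 * S) - 1)"
    using \<alpha> \<beta> S0 by (intro add_mono mult_mono) auto
  also have "\<dots> = exp (3 * S) - 1"
    by (simp add: algebra_simps flip: exp_add)
  also have "\<dots> \<le> 6 * S"
    using exp_bound[of "3 * S"] S S0 mult_left_mono[of "3 * S" 1 "3 * S"] by (simp add: power2_eq_square)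
  finally show "norm ((\<Prod>a\<in>A. 1 - x a) / (\<Prod>b\<in>B. 1 - y b) - 1) \<le> 6 * S" .
qed

text \<open>
  The numerator has \<open>s i\<close> factors for the degree \<open>i\<close>, each at distance at most
  \<open>(norm z + 1) s i / n i\<close> from \<open>1\<close>, and \<open>\<Sum>i. (s i)\<^sup>2 \<le> m\<^sup>2\<close>; the denominator is treated alike.
\<close>

lemma rel_ratio_bound:
  fixes z :: "'a::real_normed_field"
  assumes I: "finite I" and s: "sum s I > 0" and L: "L > 0" "\<And>i. i \<in> I \<Longrightarrow> s i > 0 \<Longrightarrow> real (n i) \<ge> L"
    and S: "S = (norm z + 1) * real (sum s I) ^ 2 / L" "S \<le> 1/3"
  shows "norm (rel_ratio I n s z - 1) \<le> 6 * S"
    and "j < sum s I - 1 \<Longrightarrow> (1 + z * of_nat (sum s I - 1) + of_nat j) / of_nat (sum n I) \<noteq> 1"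
proof -
  define N m where "N = sum n I" and "m = sum s I"
  define A where "A = (SIGMA i:I. {..<s i})"
  define x :: "nat \<times> nat \<Rightarrow> 'a" where "x = (\<lambda>(i, j). (z * of_nat (s i) + of_nat j) / of_nat (n i))"
  define y :: "nat \<Rightarrow> 'a" where "y j = (1 + z * of_nat (m - 1) + of_nat j) / of_nat N" for j
  obtain i where "i \<in> I" "s i > 0"
    using s by (metis sum.neutral not_gr_zero less_irrefl)
  then have NL: "L \<le> real N"
    using L(2)[of i] member_le_sum[of i I n] I unfolding N_def by (simp add: order_trans[OF L(2)] del: of_nat_sum)
  have sm: "s i \<le> m" if "i \<in> I" for i
    using member_le_sum[of i I s] I that by (simp add: m_def)
  have A: "finite A" using I by (simp add: A_def)
  have "(\<Sum>a\<in>A. norm (x a)) = (\<Sum>i\<in>I. \<Sum>j<s i. norm ((z * of_nat (s i) + of_nat j) / of_nat (n i) :: 'a))"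
    unfolding A_def x_def using I by (simp add: sum.Sigma split_beta)
  also have "\<dots> \<le> (\<Sum>i\<in>I. \<Sum>j<s i. (norm z + 1) * real m / L)"
  proof (intro sum_mono)
    fix i j assume i: "i \<in> I" and j: "j \<in> {..<s i}"
    have "norm (z * of_nat (s i) + of_nat j) \<le> norm z * real (s i) + real j"
      by (metis norm_mult norm_of_nat norm_triangle_ineq)
    also have "\<dots> \<le> norm z * real m + real m"
      using sm[OF i] j by (intro add_mono mult_left_mono) auto
    also have "\<dots> = (norm z + 1) * real m" by (simp add: algebra_simps)
    finally have "norm (z * of_nat (s i) + of_nat j) / real (n i) \<le> (norm z + 1) * real m / L"
      using L(1) L(2)[OF i] j by (intro frac_le) auto
    then show "norm ((z * of_nat (s i) + of_nat j) / of_nat (n i)) \<le> (norm z + 1) * real m / L"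
      by (simp add: norm_divide)
  qed
  also have "\<dots> = S"
    by (simp add: S m_def power2_eq_square flip: sum_distrib_right sum_divide_distrib)
  finally have xS: "(\<Sum>a\<in>A. norm (x a)) \<le> S" .
  have "(\<Sum>j<m - 1. norm (y j)) \<le> (\<Sum>j<m - 1. (norm z + 1) * real m / L)"
  proof (intro sum_mono)
    fix j assume j: "j \<in> {..<m - 1}"
    have "norm (1 + z * of_nat (m - 1) + of_nat j) = norm (z * of_nat (m - 1) + of_nat (Suc j))"
      by (simp add: algebra_simps)
    also have "\<dots> \<le> norm z * real (m - 1) + real (Suc j)"
      by (metis norm_mult norm_of_nat norm_triangle_ineq)
    also have "\<dots> \<le> norm z * real m + real m"
      using j by (intro add_mono mult_left_mono) auto
    also have "\<dots> = (norm z + 1) * real m" by (simp add: algebra_simps)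
    finally have "norm (1 + z * of_nat (m - 1) + of_nat j) / real N \<le> (norm z + 1) * real m / L"
      using L(1) NL by (intro frac_le) auto
    then show "norm (y j) \<le> (norm z + 1) * real m / L"
      by (simp add: norm_divide y_def)
  qed
  also have "\<dots> \<le> real m * ((norm z + 1) * real m / L)"
    using L(1) by (simp del: times_divide_eq_right) (intro mult_right_mono, auto)
  also have "\<dots> = S" by (simp add: S m_def power2_eq_square)
  finally have yS: "(\<Sum>j<m - 1. norm (y j)) \<le> S" .
  have "rel_ratio I n s z = (\<Prod>a\<in>A. 1 - x a) / (\<Prod>j<m - 1. 1 - y j)"
    unfolding rel_ratio_def A_def x_def y_def N_def m_def using I by (simp add: prod.Sigma split_beta)
  then show "norm (rel_ratio I n s z - 1) \<le> 6 * S"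
    using norm_prod_quotient_minus_1_le(1)[OF A xS _ yS S(2)] by simp
  show "(1 + z * of_nat (sum s I - 1) + of_nat j) / of_nat (sum n I) \<noteq> 1" if "j < sum s I - 1"
    using norm_prod_quotient_minus_1_le(2)[OF A xS _ yS S(2), of j] that by (simp add: y_def N_def m_def)
qed

text \<open>
  One of the \<open>m\<close> factors of the weight is kept, the others are at most \<open>q\<close>.
\<close>

lemma param_le:
  assumes I: "finite I" and q: "0 \<le> q" "\<And>i. i \<in> I \<Longrightarrow> real (n i) \<le> q * real (sum n I)"
    and i: "i \<in> I" "s i > 0"
  shows "param I n s \<le> real (n i) * q ^ (sum s I - 1)"
proof (cases "sum n I = 0")
  case False
  define a where "a j = real (n j) / real (sum n I)" for j
  have a: "0 \<le> a j" "j \<in> I \<Longrightarrow> a j \<le> q" for j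
    using False q(2)[of j] by (auto simp: a_def divide_le_eq simp del: of_nat_sum)
  have "(\<Prod>j\<in>I. a j ^ s j) = a i ^ s i * (\<Prod>j\<in>I - {i}. a j ^ s j)"
    using I i by (simp add: prod.remove)
  also have "\<dots> \<le> (a i * q ^ (s i - 1)) * (\<Prod>j\<in>I - {i}. q ^ s j)"
  proof (intro mult_mono prod_mono)
    have "a i ^ s i = a i * a i ^ (s i - 1)" using i by (simp flip: power_Suc)
    then show "a i ^ s i \<le> a i * q ^ (s i - 1)"
      using a[of i] i by (simp add: mult_left_mono power_mono)
  qed (use a q in \<open>auto intro: power_mono prod_nonneg\<close>)
  also have "\<dots> = a i * q ^ (s i - 1 + sum s (I - {i}))"
    by (simp add: power_add power_sum)
  also have "s i - 1 + sum s (I - {i}) = sum s I - 1"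
    using I i by (simp add: sum.remove[of I i])
  finally have "real (sum n I) * (\<Prod>j\<in>I. a j ^ s j) \<le> real (sum n I) * (a i * q ^ (sum s I - 1))"
    by (intro mult_left_mono) (auto simp del: of_nat_sum)
  then show ?thesis using False by (simp add: param_def a_def del: of_nat_sum)
qed (use q in \<open>simp add: param_def\<close>)

section \<open>Upper bounds when the parameter is small\<close>

lemma ffall_nonneg: "real b \<le> x + 1 \<Longrightarrow> 0 \<le> ffall (x::real) b"
  unfolding ffall_def by (intro prod_nonneg) auto

lemma ffall_mono: "x \<le> y \<Longrightarrow> real b \<le> x + 1 \<Longrightarrow> ffall (x::real) b \<le> ffall y b"
  unfolding ffall_def by (intro prod_mono) auto

lemma ffall_le_power: "real b \<le> x + 1 \<Longrightarrow> 0 \<le> x \<Longrightarrow> ffall (x::real) b \<le> x ^ b"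
  unfolding ffall_def using prod_mono[of "{..<b}" "\<lambda>j. x - real j" "\<lambda>j. x"] by auto

lemma ffall_ge_power:
  assumes "real b \<le> (x::real)"
  shows "(x - real b) ^ b \<le> ffall x b"
  unfolding ffall_def using prod_mono[of "{..<b}" "\<lambda>j. x - real b" "\<lambda>j. x - real j"] assms by auto

lemma ffall_pos: "real b < x + 1 \<Longrightarrow> 0 < ffall (x::real) b"
  unfolding ffall_def by (intro prod_pos) auto

text \<open>
  Arranging \<open>b i\<close> out of \<open>a i\<close> objects for each \<open>i\<close> is a way of arranging \<open>\<Sum>i. b i\<close> out of all objects.
\<close>

lemma prod_ffall_le:
  assumes "finite I" "\<And>i. i \<in> I \<Longrightarrow> b i \<le> a i"
  shows "(\<Prod>i\<in>I. ffall (real (a i)) (b i)) \<le> ffall (real (sum a I)) (sum b I)"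
  using assms
proof (induction I)
  case (insert i I)
  have le: "sum b I \<le> sum a I" using insert by (intro sum_mono) auto
  have bi: "b i \<le> a i" "real (b i) \<le> real (a i) + 1" using insert.prems[of i] by auto
  have "(\<Prod>j\<in>insert i I. ffall (real (a j)) (b j)) \<le> ffall (real (a i)) (b i) * ffall (real (sum a I)) (sum b I)"
    using insert bi by (auto intro!: mult_left_mono ffall_nonneg simp del: of_nat_sum)
  also have "\<dots> \<le> ffall (real (a i) + real (sum a I)) (b i) * ffall (real (a i) + real (sum a I) - real (b i)) (sum b I)"
    using le bi by (intro mult_mono ffall_mono ffall_nonneg) (auto simp del: of_nat_sum)
  also have "\<dots> = ffall (real (sum a (insert i I))) (sum b (insert i I))"
    using insert by (simp add: ffall_add)
  finally show ?case .
qed simp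

lemma exists_subfunction_with_sum:
  fixes s :: "'a \<Rightarrow> nat"
  assumes "finite I" "l \<le> sum s I"
  shows "\<exists>s'. (\<forall>i. s' i \<le> s i) \<and> sum s' I = l"
  using assms(2)
proof (induction l)
  case 0
  then show ?case by (intro exI[of _ "\<lambda>_. 0"]) simp
next
  case (Suc l)
  then obtain s' where s': "\<forall>i. s' i \<le> s i" "sum s' I = l" by auto
  have "\<exists>i\<in>I. s' i < s i"
  proof (rule ccontr)
    assume "\<not> ?thesis"
    then have "sum s I \<le> sum s' I" by (intro sum_mono) (auto simp: not_less)
    then show False using s' Suc.prems by simp
  qed
  then obtain i where i: "i \<in> I" "s' i < s i" by blast
  have "sum (s'(i := s' i + 1)) I = Suc l"
    using i s' assms(1) sum.remove[of I i s'] by (subst sum.remove[of _ i]) (auto cong: sum.cong_simp)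
  then show ?case using s' i by (intro exI[of _ "s'(i := s' i + 1)"]) auto
qed

text \<open>
  The left-hand side is the probability that the first \<open>m\<close> letters of a random arrangement of the
  multiset \<open>n\<close> spell a given word with letter counts \<open>s\<close>. It is at most the probability for the first \<open>l\<close>
  letters, and each of these is hit with probability at most \<open>q N / (N - l)\<close>. As the order of
  the letters is immaterial, any \<open>s' \<le> s\<close> of total \<open>l\<close> can play the role of the first letters.
\<close>

lemma prod_ffall_quotient_le:
  assumes I: "finite I" and sn: "\<And>i. i \<in> I \<Longrightarrow> s i \<le> n i"
    and q: "\<And>i. i \<in> I \<Longrightarrow> real (n i) \<le> q * real (sum n I)"
    and l: "l \<le> sum s I" "l < sum n I"
  shows "(\<Prod>i\<in>I. ffall (real (n i)) (s i)) / ffall (real (sum n I)) (sum s I) \<le>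
     (q * real (sum n I) / (real (sum n I) - real l)) ^ l"
proof -
  define N m where "N = sum n I" and "m = sum s I"
  obtain s' where s': "\<forall>i. s' i \<le> s i" "sum s' I = l"
    using exists_subfunction_with_sum[OF I l(1)] by blast
  have s'n: "s' i \<le> n i" if "i \<in> I" for i
    using s' sn[OF that] order_trans by blast
  have mN: "m \<le> N" unfolding m_def N_def using sn by (rule sum_mono)
  have split: "ffall (real (n i)) (s i) = ffall (real (n i)) (s' i) * ffall (real (n i - s' i)) (s i - s' i)"
    if "i \<in> I" for i
    using ffall_add[of "real (n i)" "s' i" "s i - s' i"] s' s'n[OF that] by (simp add: of_nat_diff)
  have "(\<Prod>i\<in>I. ffall (real (n i)) (s i)) =
      (\<Prod>i\<in>I. ffall (real (n i)) (s' i)) * (\<Prod>i\<in>I. ffall (real (n i - s' i)) (s i - s' i))"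
    by (simp add: split flip: prod.distrib)
  also have "\<dots> \<le> (\<Prod>i\<in>I. (q * real N) ^ s' i) * ffall (real (\<Sum>i\<in>I. n i - s' i)) (\<Sum>i\<in>I. s i - s' i)"
  proof (intro mult_mono prod_ffall_le I)
    show "(\<Prod>i\<in>I. ffall (real (n i)) (s' i)) \<le> (\<Prod>i\<in>I. (q * real N) ^ s' i)"
    proof (rule prod_mono, safe)
      fix i assume i: "i \<in> I"
      show "0 \<le> ffall (real (n i)) (s' i)" using s'n[OF i] by (intro ffall_nonneg) auto
      have "ffall (real (n i)) (s' i) \<le> real (n i) ^ s' i"
        using s'n[OF i] by (intro ffall_le_power) auto
      also have "\<dots> \<le> (q * real N) ^ s' i"
        using q[OF i] by (intro power_mono) (auto simp: N_def)
      finally show "ffall (real (n i)) (s' i) \<le> (q * real N) ^ s' i" .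
    qed
    show "s i - s' i \<le> n i - s' i" if "i \<in> I" for i
      using sn[OF that] by simp
    show "0 \<le> (\<Prod>i\<in>I. (q * real N) ^ s' i)"
    proof (rule prod_nonneg)
      fix i assume "i \<in> I"
      then have "0 \<le> q * real N" using q[of i] of_nat_0_le_iff[of "n i"] unfolding N_def by (meson order_trans)
      then show "0 \<le> (q * real N) ^ s' i" by simp
    qed
    show "0 \<le> (\<Prod>i\<in>I. ffall (real (n i - s' i)) (s i - s' i))"
    proof (intro prod_nonneg ffall_nonneg)
      fix i assume "i \<in> I"
      then show "real (s i - s' i) \<le> real (n i - s' i) + 1"
        using sn[of i] by (simp add: of_nat_diff diff_le_mono le_SucI del: of_nat_diff)
    qed
  qed
  also have "(\<Prod>i\<in>I. (q * real N) ^ s' i) = (q * real N) ^ l"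
    unfolding s'(2)[symmetric] by (rule power_sum[symmetric])
  also have "(\<Sum>i\<in>I. n i - s' i) = N - l"
    using s' s'n by (simp add: sum_subtractf_nat N_def)
  also have "(\<Sum>i\<in>I. s i - s' i) = m - l"
    using s' by (simp add: sum_subtractf_nat m_def)
  finally have num: "(\<Prod>i\<in>I. ffall (real (n i)) (s i)) \<le> (q * real N) ^ l * ffall (real (N - l)) (m - l)" .
  have lN: "l < N" "l \<le> m" using l by (auto simp: N_def m_def)
  have den: "ffall (real N) m = ffall (real N) l * ffall (real (N - l)) (m - l)"
    using ffall_add[of "real N" l "m - l"] lN by (simp add: of_nat_diff)
  have p1: "0 < ffall (real N) l" using lN by (intro ffall_pos) auto
  have p2: "0 < ffall (real (N - l)) (m - l)" using lN mN by (intro ffall_pos) auto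
  have p3: "0 < (real N - real l) ^ l" using lN by simp
  have "(\<Prod>i\<in>I. ffall (real (n i)) (s i)) / ffall (real N) m \<le> (q * real N) ^ l * ffall (real (N - l)) (m - l) / ffall (real N) m"
    using num p1 p2 by (intro divide_right_mono) (auto simp: den)
  also have "\<dots> = (q * real N) ^ l / ffall (real N) l"
    using p2 by (simp add: den)
  also have "\<dots> \<le> (q * real N) ^ l / (real N - real l) ^ l"
  proof (cases "l = 0")
    case False
    then have "sum s' I \<noteq> 0" using s' by simp
    then obtain i where "i \<in> I" by (metis sum.empty ex_in_conv)
    then have "0 \<le> q * real N" using q[of i] of_nat_0_le_iff[of "n i"] unfolding N_def by (meson order_trans)
    then show ?thesis
      using p1 p3 lN by (intro divide_left_mono ffall_ge_power) auto
  qed simp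
  finally show ?thesis by (simp add: N_def m_def power_divide)
qed

lemma moment_ratio_nonneg:
  assumes I: "finite I" and sn: "\<And>i. i \<in> I \<Longrightarrow> Suc r * s i \<le> n i"
  shows "0 \<le> moment_ratio I n s r"
proof (cases "sum s I = 0")
  case False
  have 1: "real (s i) \<le> real (n i) - real (r * s i) + 1" if "i \<in> I" for i
    using of_nat_mono[OF sn[OF that], where 'a = real] by (simp add: algebra_simps)
  have "Suc r * sum s I \<le> sum n I" unfolding sum_distrib_left using sn by (rule sum_mono)
  then have "real (Suc r * sum s I) \<le> real (sum n I)" by (rule of_nat_mono)
  moreover have "real (sum s I - 1) = real (sum s I) - 1" using False by (simp add: of_nat_diff)
  ultimately have 2: "real (sum s I - 1) \<le> real (sum n I) - 1 - real (r * (sum s I - 1)) + 1"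
    using False by (simp add: algebra_simps del: of_nat_sum)
  then show ?thesis
    unfolding moment_ratio_def by (intro divide_nonneg_nonneg prod_nonneg ffall_nonneg 1 2)
qed (simp add: moment_ratio_def prod_nonneg sum_nonneg_eq_0_iff I)

text \<open>
  For trees of size \<open>O(sqrt N)\<close> the ratio is comparable to the parameter: the numerator is at most
  \<open>\<Prod>i. n i ^ s i\<close>, and the denominator is at least half of \<open>N ^ (m - 1)\<close>. The constant \<open>18\<close> makes
  \<open>norm_prod_quotient_minus_1_le\<close> yield an error of at most \<open>1/3\<close>.
\<close>

lemma moment_ratio_le_param:
  assumes I: "finite I" and s: "sum s I > 0"
    and sn: "\<And>i. i \<in> I \<Longrightarrow> Suc r * s i \<le> n i"
    and small: "18 * real (Suc r) * real (sum s I) ^ 2 \<le> real (sum n I)"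
  shows "moment_ratio I n s r \<le> 2 * param I n s"
proof -
  define N m where "N = sum n I" and "m = sum s I"
  define x where "x i j = (real r * real (s i) + real j) / real (n i)" for i j
  define y where "y j = (1 + real r * real (m - 1) + real j) / real N" for j
  have "N > 0" using small s unfolding N_def
    by (metis less_irrefl mult_pos_pos not_gr_zero of_nat_0 of_nat_0_less_iff zero_less_numeral zero_less_power not_le zero_less_Suc)
  have "(\<Sum>j<m - 1. norm (y j)) \<le> (\<Sum>j<m - 1. real (Suc r) * real m / real N)"
  proof (intro sum_mono)
    fix j assume "j \<in> {..<m - 1}"
    then have "1 + real r * real (m - 1) + real j \<le> real (Suc r) * real m"
      by (simp add: algebra_simps of_nat_diff)
    then show "norm (y j) \<le> real (Suc r) * real m / real N"
      by (simp add: y_def divide_right_mono)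
  qed
  also have "\<dots> \<le> real m * (real (Suc r) * real m / real N)"
    by (simp del: times_divide_eq_right of_nat_Suc) (intro mult_right_mono, auto)
  also have "\<dots> = real (Suc r) * real m ^ 2 / real N" by (simp add: power2_eq_square)
  also have "\<dots> \<le> 1/18"
    using small \<open>N > 0\<close> by (simp add: N_def m_def divide_le_eq del: of_nat_sum of_nat_Suc)
  finally have yS: "(\<Sum>j<m - 1. norm (y j)) \<le> 1/18" .
  have "norm ((\<Prod>a\<in>{}. 1 - (0::real)) / (\<Prod>j<m - 1. 1 - y j) - 1) \<le> 6 * (1/18)"
    by (rule norm_prod_quotient_minus_1_le) (use yS in auto)
  then have den: "1 / (\<Prod>j<m - 1. 1 - y j) \<le> 2" by (simp add: abs_if split: if_splits)
  have x01: "0 \<le> 1 - x i j \<and> 1 - x i j \<le> 1" if "i \<in> I" "j < s i" for i j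
  proof -
    have "real (Suc r * s i) \<le> real (n i)" using sn[OF that(1)] by (rule of_nat_mono)
    then have "real r * real (s i) + real j \<le> real (n i)" using that by (simp add: algebra_simps)
    then show ?thesis by (simp add: x_def divide_le_eq)
  qed
  have num0: "0 \<le> (\<Prod>i\<in>I. \<Prod>j<s i. 1 - x i j)" using x01 by (intro prod_nonneg) auto
  have num1: "(\<Prod>i\<in>I. \<Prod>j<s i. 1 - x i j) \<le> 1"
    using x01 by (intro prod_le_1 conjI prod_nonneg) auto
  have "rel_ratio I n s (real r) = (\<Prod>i\<in>I. \<Prod>j<s i. 1 - x i j) * (1 / (\<Prod>j<m - 1. 1 - y j))"
    by (simp add: rel_ratio_def x_def y_def N_def m_def)
  also have "\<dots> \<le> (\<Prod>i\<in>I. \<Prod>j<s i. 1 - x i j) * 2"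
    using num0 den by (intro mult_left_mono)
  finally have "rel_ratio I n s (real r) \<le> 2" using num1 by simp
  moreover have "param I n s \<ge> 0" by (simp add: param_def prod_nonneg sum_nonneg)
  moreover have "moment_ratio I n s r = param I n s * rel_ratio I n s (real r)"
    using sn by (intro moment_ratio_eq I s) fastforce
  ultimately show ?thesis using mult_left_mono[of "rel_ratio I n s (real r)" 2 "param I n s"] by simp
qed

text \<open>
  For larger trees, removing \<open>r\<close> copies of \<open>S\<close> leaves \<open>n' = n - r s\<close>. As one more copy fits,
  \<open>n' \<ge> n / (r + 1)\<close>, so that no degree takes up more than a proportion \<open>q' < 1\<close> of \<open>n'\<close>, and
  \<open>prod_ffall_quotient_le\<close> applies to \<open>n'\<close>. The upper bound on \<open>l\<close> keeps the denominators \<open>N' - l\<close> above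
  \<open>(1 + q') / 2\<close> times \<open>N'\<close>.
\<close>

lemma moment_ratio_le_exponential:
  assumes I: "finite I" and s: "sum s I > 0"
    and sn: "\<And>i. i \<in> I \<Longrightarrow> Suc r * s i \<le> n i"
    and q: "q \<le> 1" "\<And>i. i \<in> I \<Longrightarrow> real (n i) \<le> q * real (sum n I)"
  defines "N \<equiv> sum n I" and "q' \<equiv> 1 - (1 - q) / real (Suc r)"
  assumes l: "l \<le> sum s I" "real l \<le> (1 - q') / 2 * (real N / real (Suc r))" "q' < 1" "q' \<ge> 0"
  shows "moment_ratio I n s r \<le> real N * (2 * q' / (1 + q')) ^ l"
proof -
  define m where "m = sum s I"
  define n' where "n' i = n i - r * s i" for i
  define N' where "N' = sum n' I"
  have sn': "s i \<le> n' i" if "i \<in> I" for i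
    using sn[OF that] by (simp add: n'_def)
  have n'r: "real (n' i) = real (n i) - real (r * s i)" if "i \<in> I" for i
    using sn[OF that] by (simp add: n'_def of_nat_diff)
  have n'_ge: "real (n i) / real (Suc r) \<le> real (n' i)" if "i \<in> I" for i
  proof -
    have "r * (Suc r * s i) \<le> r * n i" using sn[OF that] by (rule mult_left_mono) simp
    then have "real (r * (Suc r * s i)) \<le> real (r * n i)" by (rule of_nat_mono)
    then have "real (n i) \<le> real (Suc r) * real (n' i)"
      unfolding n'r[OF that] by (simp add: algebra_simps)
    then show ?thesis by (simp add: divide_le_eq mult.commute)
  qed
  have N'_eq: "real N' = real N - real (r * m)"
    unfolding N'_def N_def m_def of_nat_sum by (simp add: n'r sum_subtractf sum_distrib_left)
  have N'_ge: "real N / real (Suc r) \<le> real N'"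
    unfolding N'_def N_def of_nat_sum sum_divide_distrib using n'_ge by (rule sum_mono)
  have mN': "m \<le> N'" unfolding m_def N'_def using sn' by (rule sum_mono)
  \<comment> \<open>The other degrees retain at least a proportion \<open>1 / (r + 1)\<close> of their total number \<open>N - n i \<ge> (1 - q) N\<close>.\<close>
  have q': "real (n' i) \<le> q' * real N'" if "i \<in> I" for i
  proof -
    have "(1 - q) / real (Suc r) * real N' \<le> (1 - q) / real (Suc r) * real N"
      using q(1) N'_eq by (intro mult_left_mono) auto
    also have "\<dots> \<le> (real N - real (n i)) / real (Suc r)"
      using q(2)[OF that] by (simp add: N_def divide_right_mono algebra_simps del: of_nat_Suc of_nat_sum)
    also have "real N - real (n i) = (\<Sum>j\<in>I - {i}. real (n j))"
      using I that by (simp add: N_def sum.remove[of I i])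
    also have "\<dots> / real (Suc r) \<le> (\<Sum>j\<in>I - {i}. real (n' j))"
      unfolding sum_divide_distrib using n'_ge by (intro sum_mono) auto
    also have "\<dots> = real N' - real (n' i)"
      using I that by (simp add: N'_def sum.remove[of I i])
    finally show ?thesis by (simp add: q'_def algebra_simps)
  qed
  have N'pos: "N' > 0" using mN' s by (simp add: m_def)
  have lN': "real l \<le> (1 - q') / 2 * real N'"
    using l(3) by (intro order_trans[OF l(2)] mult_left_mono N'_ge) simp
  also have "\<dots> < 1 * real N'" using N'pos l(4) by (intro mult_strict_right_mono) auto
  finally have "l < N'" by simp
  have D: "ffall (real N') m = real N' * ffall (real N' - 1) (m - 1)"
    using ffall_add[of "real N'" 1 "m - 1"] s by (simp add: m_def ffall_def)
  have "m > 0" using s by (simp add: m_def)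
  then have m1: "real (m - 1) = real m - 1" by (simp add: of_nat_diff)
  have Dpos: "0 < ffall (real N' - 1) (m - 1)" using mN' \<open>m > 0\<close> by (intro ffall_pos) auto
  have "ffall (real N' - 1) (m - 1) \<le> ffall (real N - 1 - real (r * (m - 1))) (m - 1)"
  proof (rule ffall_mono)
    have "real (r * (m - 1)) \<le> real (r * m)" by (intro of_nat_mono mult_le_mono2) simp
    then show "real N' - 1 \<le> real N - 1 - real (r * (m - 1))" unfolding N'_eq by linarith
    show "real (m - 1) \<le> real N' - 1 + 1" using mN' by simp
  qed
  then have "moment_ratio I n s r \<le> (\<Prod>i\<in>I. ffall (real (n i) - real (r * s i)) (s i)) / ffall (real N' - 1) (m - 1)"
    unfolding moment_ratio_def N_def[symmetric] m_def[symmetric]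
    using Dpos
  proof (intro divide_left_mono prod_nonneg ffall_nonneg)
    fix i assume "i \<in> I"
    then show "real (s i) \<le> real (n i) - real (r * s i) + 1"
      using of_nat_mono[OF sn'[of i], where 'a = real] n'r[of i] by linarith
  qed auto
  also have "\<dots> = real N' * ((\<Prod>i\<in>I. ffall (real (n' i)) (s i)) / ffall (real N') m)"
    using N'pos by (simp add: D n'r)
  also have "\<dots> \<le> real N' * (q' * real N' / (real N' - real l)) ^ l"
    using prod_ffall_quotient_le[OF I sn' q'[unfolded N'_def] l(1) \<open>l < N'\<close>[unfolded N'_def]]
    by (intro mult_left_mono) (simp_all only: N'_def m_def of_nat_0_le_iff)
  also have "\<dots> \<le> real N * (2 * q' / (1 + q')) ^ l"
  proof (intro mult_mono power_mono)
    have "(1 + q') / 2 * real N' \<le> real N' - real l" using lN' by (simp add: field_simps)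
    moreover have "0 < (1 + q') / 2 * real N'" using l(4) N'pos by (intro mult_pos_pos) auto
    ultimately have "q' * real N' / (real N' - real l) \<le> q' * real N' / ((1 + q') / 2 * real N')"
      using l(4) by (intro divide_left_mono) (auto intro!: mult_pos_pos)
    also have "\<dots> = 2 * q' / (1 + q')" using N'pos by (subst mult_divide_mult_cancel_right) simp_all
    finally show "q' * real N' / (real N' - real l) \<le> 2 * q' / (1 + q')" .
    show "0 \<le> q' * real N' / (real N' - real l)" using l(4) \<open>l < N'\<close> by simp
    then show "0 \<le> (q' * real N' / (real N' - real l)) ^ l" by simp
  qed (use N'_eq in auto)
  finally show ?thesis .
qed

section \<open>Finite differences of holomorphic functions\<close>

definition cdiff :: "(complex \<Rightarrow> complex) \<Rightarrow> complex \<Rightarrow> complex" where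
  "cdiff h z = h (z + 1) - h z"

lemma cdiff_of_nat: "(cdiff ^^ b) h (of_nat r) = (fdiff ^^ b) (\<lambda>r. h (of_nat r)) r"
proof (induction b arbitrary: r)
  case (Suc b)
  have "of_nat r + 1 = (of_nat (Suc r) :: complex)" by simp
  moreover have "(cdiff ^^ Suc b) h z = (cdiff ^^ b) h (z + 1) - (cdiff ^^ b) h z" for z
    by (simp add: cdiff_def)
  ultimately show ?case by (simp only: fdiff_Suc Suc.IH)
qed simp

lemma fdiff_of_real: "(fdiff ^^ b) (\<lambda>r. of_real (g r)) r = of_real ((fdiff ^^ b) g r)"
  by (induction b arbitrary: r) (simp_all add: fdiff_def)

text \<open>
  By Cauchy's estimate the derivative is at most \<open>B / R\<close> on the disc of radius \<open>2 R\<close>, which contains the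
  segment from \<open>z\<close> to \<open>z + 1\<close>.
\<close>

lemma cdiff_bound:
  assumes h: "h holomorphic_on ball 0 (4 * R)" and B: "\<And>z. z \<in> ball 0 (4 * R) \<Longrightarrow> norm (h z) \<le> B"
    and R: "R \<ge> 1" and z: "z \<in> ball 0 R"
  shows "norm (cdiff h z) \<le> B / R"
proof -
  have deriv: "norm (deriv h w) \<le> B / R" if w: "w \<in> ball 0 (2 * R)" for w
  proof -
    have sub: "cball w R \<subseteq> ball 0 (4 * R)"
    proof
      fix u assume "u \<in> cball w R"
      then have "norm u \<le> norm w + R" using norm_triangle_ineq[of w "u - w"] by (simp add: dist_norm norm_minus_commute)
      then show "u \<in> ball 0 (4 * R)" using w R by simp
    qed
    have "norm ((deriv ^^ 1) h w) \<le> fact 1 * B / R ^ 1"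
    proof (rule Cauchy_inequality)
      show "h holomorphic_on ball w R"
        by (rule holomorphic_on_subset[OF h order_trans[OF ball_subset_cball sub]])
      show "continuous_on (cball w R) h"
        by (rule holomorphic_on_imp_continuous_on[OF holomorphic_on_subset[OF h sub]])
      show "norm (h x) \<le> B" if "norm (w - x) = R" for x
      proof (rule B)
        have "x \<in> cball w R" using that by (simp add: dist_norm)
        with sub show "x \<in> ball 0 (4 * R)" by blast
      qed
    qed (use R in auto)
    then show ?thesis by simp
  qed
  have "norm (h (z + 1) - h z) \<le> B / R * norm (z + 1 - z)"
  proof (rule field_differentiable_bound[of "ball 0 (2 * R)"])
    show "(h has_field_derivative deriv h w) (at w within ball 0 (2 * R))" if "w \<in> ball 0 (2 * R)" for w
      by (rule has_field_derivative_at_within, rule holomorphic_derivI[OF h]) (use that R in auto)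
    show "z + 1 \<in> ball 0 (2 * R)"
      using z R norm_triangle_ineq[of z 1] by simp
  qed (use z R deriv in auto)
  then show ?thesis by (simp add: cdiff_def)
qed

lemma cdiff_holomorphic:
  assumes "h holomorphic_on ball 0 (4 * R)" "R \<ge> 1"
  shows "cdiff h holomorphic_on ball 0 R"
proof -
  have "(\<lambda>z. h (z + 1)) holomorphic_on ball 0 R"
  proof (rule holomorphic_on_compose_gen[of "\<lambda>z. z + 1" _ h "ball 0 (4 * R)", unfolded o_def])
    show "(\<lambda>z::complex. z + 1) ` ball 0 R \<subseteq> ball 0 (4 * R)"
    proof (rule image_subsetI)
      fix z :: complex assume "z \<in> ball 0 R"
      then show "z + 1 \<in> ball 0 (4 * R)" using assms(2) norm_triangle_ineq[of z 1] by simp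
    qed
    show "(\<lambda>z::complex. z + 1) holomorphic_on ball 0 R" by (intro holomorphic_intros)
  qed (rule assms)
  moreover have "h holomorphic_on ball 0 R"
    using assms by (elim holomorphic_on_subset) auto
  ultimately show ?thesis unfolding cdiff_def[abs_def] by (rule holomorphic_on_diff)
qed

text \<open>
  Every difference shrinks the disc of radius \<open>c \<sigma>\<close> by a constant factor and gains a factor of order
  \<open>1 / \<sigma>\<close> in the bound.
\<close>

lemma cdiff_tendsto_0:
  fixes \<sigma> :: "nat \<Rightarrow> real"
  assumes \<sigma>: "filterlim \<sigma> at_top sequentially" and c: "c > 0"
    and h: "\<forall>\<^sub>F k in sequentially. h k holomorphic_on ball 0 (c * \<sigma> k) \<and>
              (\<forall>z\<in>ball 0 (c * \<sigma> k). norm (h k z) \<le> B k)"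
    and B: "(\<lambda>k. \<sigma> k ^ d * B k) \<longlonglongrightarrow> 0"
  shows "(\<lambda>k. of_real (\<sigma> k ^ (b + d)) * (cdiff ^^ b) (h k) (of_nat r)) \<longlonglongrightarrow> 0"
  using c h B
proof (induction b arbitrary: c h B d)
  case 0
  have "\<forall>\<^sub>F k in sequentially. \<sigma> k > (real r + 1) / c"
    using \<sigma>[unfolded filterlim_at_top_dense] by blast
  then have "\<forall>\<^sub>F k in sequentially. norm (of_real (\<sigma> k ^ (0 + d)) * (cdiff ^^ 0) (h k) (of_nat r)) \<le> \<sigma> k ^ d * B k"
    using "0.prems"(2)
  proof eventually_elim
    case (elim k)
    have "real r + 1 < c * \<sigma> k" using elim(1) "0.prems"(1) by (simp add: divide_less_eq mult.commute)
    then have "norm (h k (of_nat r)) \<le> B k" using elim(2) by auto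
    moreover have "0 < (real r + 1) / c" using "0.prems"(1) by (intro divide_pos_pos) auto
    then have "0 < \<sigma> k" using elim(1) by linarith
    ultimately show ?case by (simp add: norm_mult norm_power mult_left_mono)
  qed
  then show ?case by (rule Lim_null_comparison) (rule "0.prems")
next
  case (Suc b)
  have "\<forall>\<^sub>F k in sequentially. \<sigma> k > 4 / c"
    using \<sigma>[unfolded filterlim_at_top_dense] by blast
  then have "\<forall>\<^sub>F k in sequentially. cdiff (h k) holomorphic_on ball 0 (c / 4 * \<sigma> k) \<and>
      (\<forall>z\<in>ball 0 (c / 4 * \<sigma> k). norm (cdiff (h k) z) \<le> B k / (c / 4 * \<sigma> k))"
    using Suc.prems(2)
  proof eventually_elim
    case (elim k)
    define R where "R = c / 4 * \<sigma> k"
    have R: "R \<ge> 1" "4 * R = c * \<sigma> k" using elim(1) Suc.prems(1) by (auto simp: R_def field_simps)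
    show ?case
      using elim(2) cdiff_bound[of "h k" R "B k"] cdiff_holomorphic[of "h k" R] R
      unfolding R_def[symmetric] by auto
  qed
  moreover have "(\<lambda>k. \<sigma> k ^ (d + 1) * (B k / (c / 4 * \<sigma> k))) \<longlonglongrightarrow> 0"
  proof (rule Lim_transform_eventually)
    show "(\<lambda>k. 4 / c * (\<sigma> k ^ d * B k)) \<longlonglongrightarrow> 0"
      using Suc.prems(3) by (rule tendsto_mult_right_zero)
    have "\<forall>\<^sub>F k in sequentially. \<sigma> k > 0"
      using \<sigma>[unfolded filterlim_at_top_dense] by blast
    then show "\<forall>\<^sub>F k in sequentially. 4 / c * (\<sigma> k ^ d * B k) = \<sigma> k ^ (d + 1) * (B k / (c / 4 * \<sigma> k))"
      by eventually_elim (use Suc.prems(1) in \<open>simp add: field_simps\<close>)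
  qed
  ultimately have "(\<lambda>k. of_real (\<sigma> k ^ (b + (d + 1))) * (cdiff ^^ b) (cdiff (h k)) (of_nat r)) \<longlonglongrightarrow> 0"
    using Suc.prems(1) by (intro Suc.IH[of "c / 4"]) auto
  then show ?case by (simp add: funpow_swap1)
qed

lemma square_times_power_tendsto_0:
  assumes "0 < q" "q < 1" "filterlim m at_top sequentially"
  shows "(\<lambda>k. real (m k) ^ 2 * q ^ (m k - 1)) \<longlonglongrightarrow> 0"
proof -
  have "(\<lambda>j. real j * sqrt q ^ j) \<longlonglongrightarrow> 0"
    using assms by (intro powser_times_n_limit_0) (simp add: abs_if)
  then have "(\<lambda>j. (real j * sqrt q ^ j) ^ 2 / q) \<longlonglongrightarrow> 0 ^ 2 / q"
    using assms by (intro tendsto_intros) auto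
  then have "(\<lambda>j. (real j * sqrt q ^ j) ^ 2 / q) \<longlonglongrightarrow> 0" by simp
  moreover have "\<forall>\<^sub>F j in sequentially. (real j * sqrt q ^ j) ^ 2 / q = real j ^ 2 * q ^ (j - 1)"
    using eventually_gt_at_top[of 0]
  proof eventually_elim
    case (elim j)
    have "(sqrt q ^ j) ^ 2 = (sqrt q ^ 2) ^ j" by (simp flip: power_mult add: mult.commute)
    also have "\<dots> = q * q ^ (j - 1)" using assms elim by (simp flip: power_Suc)
    finally show ?case using assms by (simp add: power_mult_distrib)
  qed
  ultimately have "(\<lambda>j. real j ^ 2 * q ^ (j - 1)) \<longlonglongrightarrow> 0" by (rule Lim_transform_eventually)
  then show ?thesis using assms(3) by (rule filterlim_compose)
qed


section \<open>Asymptotics along a sequence of degree statistics\<close>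

text \<open>
  The sequences of statistics \<open>n\<close> and of tree statistics \<open>s\<close>, with \<open>I k\<close> containing all degrees that
  occur at step \<open>k\<close>. The bound by \<open>q\<close> expresses that no single degree takes up almost all vertices.
\<close>

locale degree_sequences =
  fixes I :: "nat \<Rightarrow> nat set" and n s :: "nat \<Rightarrow> nat \<Rightarrow> nat" and q :: real
  assumes fin: "\<And>k. finite (I k)"
    and size: "filterlim (\<lambda>k. sum (n k) (I k)) at_top sequentially"
    and pattern: "filterlim (\<lambda>k. sum (s k) (I k)) at_top sequentially"
    and q: "0 < q" "q < 1" "\<forall>\<^sub>F k in sequentially. \<forall>i\<in>I k. real (n k i) \<le> q * real (sum (n k) (I k))"
begin

abbreviation "N k \<equiv> sum (n k) (I k)"
abbreviation "m k \<equiv> sum (s k) (I k)"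
abbreviation "\<mu> k \<equiv> param (I k) (n k) (s k)"
abbreviation "\<epsilon> k \<equiv> real (m k) ^ 2 * q ^ (m k - 1)"

lemma eps_tendsto_0: "\<epsilon> \<longlonglongrightarrow> 0"
  using square_times_power_tendsto_0[OF q(1,2) pattern] .

lemma m_pos: "\<forall>\<^sub>F k in sequentially. m k > 0"
  using eventually_compose_filterlim[OF eventually_gt_at_top[of 0] pattern] .

lemma rel_ratio_close:
  fixes z :: "nat \<Rightarrow> 'a::real_normed_field"
  shows "\<forall>\<^sub>F k in sequentially. \<forall>z::'a. \<mu> k > 0 \<longrightarrow> (norm z + 1) * \<epsilon> k / \<mu> k \<le> 1/3 \<longrightarrow>
     norm (rel_ratio (I k) (n k) (s k) z - 1) \<le> 6 * ((norm z + 1) * \<epsilon> k / \<mu> k) \<and>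
     (\<forall>j<m k - 1. (1 + z * of_nat (m k - 1) + of_nat j) / of_nat (N k) \<noteq> 1)"
  using q(3) m_pos
proof eventually_elim
  case (elim k)
  show ?case
  proof (intro allI impI)
    fix z :: 'a assume \<mu>: "\<mu> k > 0" and small: "(norm z + 1) * \<epsilon> k / \<mu> k \<le> 1/3"
    define L where "L = \<mu> k / q ^ (m k - 1)"
    have L: "L > 0" using \<mu> q(1) by (simp add: L_def)
    have nL: "L \<le> real (n k i)" if "i \<in> I k" "s k i > 0" for i
    proof -
      have "\<mu> k \<le> real (n k i) * q ^ (m k - 1)"
        using elim(1) q(1) that by (intro param_le[OF fin]) auto
      then show ?thesis using q(1) by (simp add: L_def divide_le_eq)
    qed
    have S: "(norm z + 1) * \<epsilon> k / \<mu> k = (norm z + 1) * real (m k) ^ 2 / L"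
      using q(1) by (simp add: L_def)
    show "norm (rel_ratio (I k) (n k) (s k) z - 1) \<le> 6 * ((norm z + 1) * \<epsilon> k / \<mu> k) \<and>
     (\<forall>j<m k - 1. (1 + z * of_nat (m k - 1) + of_nat j) / of_nat (N k) \<noteq> 1)"
      using rel_ratio_bound[where n = "n k" and s = "s k", OF fin elim(2) L nL S small] by blast
  qed
qed

lemma moment_ratio_rel:
  "\<forall>\<^sub>F k in sequentially. \<forall>r. \<mu> k > 0 \<longrightarrow>
     moment_ratio (I k) (n k) (s k) r = \<mu> k * rel_ratio (I k) (n k) (s k) (real r)"
  using m_pos
proof eventually_elim
  case (elim k)
  show ?case
  proof (intro allI impI moment_ratio_eq fin elim)
    fix i assume \<mu>: "\<mu> k > 0" and i: "i \<in> I k" "s k i > 0"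
    show "n k i > 0"
    proof (rule ccontr)
      assume "\<not> n k i > 0"
      then have "(\<Prod>i\<in>I k. (real (n k i) / real (N k)) ^ s k i) = 0"
        using i fin by (intro prod_zero bexI[of _ i]) auto
      then show False using \<mu> by (simp add: param_def del: of_nat_sum)
    qed
  qed
qed

lemma moment_ratio_tendsto_pos:
  assumes \<mu>: "\<mu> \<longlonglongrightarrow> lam" and lam: "lam > 0"
  shows "(\<lambda>k. moment_ratio (I k) (n k) (s k) r) \<longlonglongrightarrow> lam"
proof -
  have \<mu>pos: "\<forall>\<^sub>F k in sequentially. \<mu> k > 0"
    using \<mu> lam by (rule order_tendstoD)
  have S0: "(\<lambda>k. (real r + 1) * \<epsilon> k / \<mu> k) \<longlonglongrightarrow> (real r + 1) * 0 / lam"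
    using lam by (intro tendsto_intros eps_tendsto_0 \<mu>) auto
  then have "\<forall>\<^sub>F k in sequentially. (real r + 1) * \<epsilon> k / \<mu> k < 1/3"
    by (rule order_tendstoD) simp
  then have *: "\<forall>\<^sub>F k in sequentially. norm (rel_ratio (I k) (n k) (s k) (real r) - 1) \<le> 6 * ((real r + 1) * \<epsilon> k / \<mu> k)"
    using rel_ratio_close[where 'a = real] \<mu>pos
  proof eventually_elim
    case (elim k)
    have "norm (real r) = real r" by simp
    then show ?case using elim(2)[rule_format, of "real r"] elim(1,3) by simp
  qed
  have "(\<lambda>k. rel_ratio (I k) (n k) (s k) (real r) - 1) \<longlonglongrightarrow> 0"
    using * by (rule Lim_null_comparison) (use tendsto_mult[OF tendsto_const S0, of 6] in simp)
  then have "(\<lambda>k. rel_ratio (I k) (n k) (s k) (real r)) \<longlonglongrightarrow> 1"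
    by (simp add: LIM_zero_iff)
  then have "(\<lambda>k. \<mu> k * rel_ratio (I k) (n k) (s k) (real r)) \<longlonglongrightarrow> lam"
    using tendsto_mult[OF \<mu>] by fastforce
  moreover have "\<forall>\<^sub>F k in sequentially. \<mu> k * rel_ratio (I k) (n k) (s k) (real r) = moment_ratio (I k) (n k) (s k) r"
    using moment_ratio_rel \<mu>pos by eventually_elim simp
  ultimately show ?thesis by (rule Lim_transform_eventually)
qed

lemma rel_ratio_fdiff_tendsto:
  assumes \<mu>: "filterlim \<mu> at_top sequentially"
  shows "(\<lambda>k. sqrt (\<mu> k) ^ (b + 1) * (fdiff ^^ b) (\<lambda>r. rel_ratio (I k) (n k) (s k) (real r) - 1) r) \<longlonglongrightarrow> 0"
proof -
  define \<sigma> where "\<sigma> k = sqrt (\<mu> k)" for k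
  define h :: "nat \<Rightarrow> complex \<Rightarrow> complex" where "h k z = rel_ratio (I k) (n k) (s k) z - 1" for k z
  define B where "B k = 12 * \<epsilon> k / \<sigma> k" for k
  have \<sigma>: "filterlim \<sigma> at_top sequentially"
    unfolding \<sigma>_def using \<mu> by (rule filterlim_compose[OF sqrt_at_top])
  have ev1: "\<forall>\<^sub>F k in sequentially. \<sigma> k > 1"
    using \<sigma>[unfolded filterlim_at_top_dense] by blast
  have ev2: "\<forall>\<^sub>F k in sequentially. \<epsilon> k < 1/6"
    using eps_tendsto_0 by (rule order_tendstoD) simp
  have hB: "\<forall>\<^sub>F k in sequentially. h k holomorphic_on ball 0 (1 * \<sigma> k) \<and> (\<forall>z\<in>ball 0 (1 * \<sigma> k). norm (h k z) \<le> B k)"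
    using rel_ratio_close[where 'a = complex] ev1 ev2
  proof eventually_elim
    case (elim k)
    have \<mu>\<sigma>: "\<mu> k = \<sigma> k ^ 2" "\<mu> k > 0" using elim(2) unfolding \<sigma>_def
      by (auto simp: real_sqrt_gt_1_iff)
    have \<epsilon>0: "\<epsilon> k \<ge> 0" using q(1) by simp
    \<comment> \<open>On this disc \<open>norm z + 1 \<le> 2 \<sigma>\<close>, while \<open>\<mu> = \<sigma>\<^sup>2\<close>.\<close>
    have S: "(norm z + 1) * \<epsilon> k / \<mu> k \<le> 2 * \<epsilon> k / \<sigma> k" if "z \<in> ball 0 (\<sigma> k)" for z :: complex
    proof -
      have "(norm z + 1) * \<epsilon> k \<le> (2 * \<sigma> k) * \<epsilon> k"
        using that elim(2) \<epsilon>0 by (intro mult_right_mono) auto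
      then have "(norm z + 1) * \<epsilon> k / \<sigma> k ^ 2 \<le> (2 * \<sigma> k) * \<epsilon> k / \<sigma> k ^ 2"
        by (intro divide_right_mono) auto
      then show ?thesis using elim(2) by (simp add: \<mu>\<sigma> power2_eq_square)
    qed
    have S3: "2 * \<epsilon> k / \<sigma> k \<le> 1/3"
      using elim(2,3) \<epsilon>0 frac_le[of "1/3" "2 * \<epsilon> k" 1 "\<sigma> k"] by simp
    have bounds: "norm (h k z) \<le> B k \<and> (\<forall>j<m k - 1. (1 + z * of_nat (m k - 1) + of_nat j) / of_nat (N k) \<noteq> 1)"
      if "z \<in> ball 0 (\<sigma> k)" for z
    proof -
      note close = elim(1)[rule_format, OF \<mu>\<sigma>(2) order_trans[OF S[OF that] S3]]
      have "norm (h k z) \<le> 6 * ((norm z + 1) * \<epsilon> k / \<mu> k)"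
        using close unfolding h_def by blast
      also have "\<dots> \<le> 6 * (2 * \<epsilon> k / \<sigma> k)"
        using S[OF that] by (rule mult_left_mono) simp
      finally show ?thesis using close by (simp add: B_def)
    qed
    have "h k holomorphic_on ball 0 (\<sigma> k)"
      unfolding h_def[abs_def] rel_ratio_def
    proof (intro holomorphic_on_diff holomorphic_on_divide holomorphic_on_const)
      show "(\<Prod>j<m k - 1. 1 - (1 + z * of_nat (m k - 1) + of_nat j) / of_nat (N k)) \<noteq> 0"
        if z: "z \<in> ball 0 (\<sigma> k)" for z :: complex
      proof -
        have "1 - (1 + z * of_nat (m k - 1) + of_nat j) / of_nat (N k) \<noteq> 0" if "j < m k - 1" for j
        proof -
          have "(1 + z * of_nat (m k - 1) + of_nat j) / of_nat (N k) \<noteq> 1"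
            using bounds[OF z] that by blast
          then show ?thesis by (metis right_minus_eq)
        qed
        then show ?thesis by (subst prod_zero_iff) auto
      qed
      show "(\<lambda>z::complex. \<Prod>j<m k - 1. 1 - (1 + z * of_nat (m k - 1) + of_nat j) / of_nat (N k)) holomorphic_on ball 0 (\<sigma> k)"
        unfolding divide_inverse
        by (intro holomorphic_on_prod holomorphic_on_diff holomorphic_on_mult holomorphic_on_add holomorphic_on_const holomorphic_on_ident)
      show "(\<lambda>z::complex. \<Prod>i\<in>I k. \<Prod>j<s k i. 1 - (z * of_nat (s k i) + of_nat j) / of_nat (n k i)) holomorphic_on ball 0 (\<sigma> k)"
        unfolding divide_inverse
        by (intro holomorphic_on_prod holomorphic_on_diff holomorphic_on_mult holomorphic_on_add holomorphic_on_const holomorphic_on_ident)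
    qed
    then show ?case using bounds by simp
  qed
  have "(\<lambda>k. 12 * \<epsilon> k) \<longlonglongrightarrow> 0"
    using eps_tendsto_0 by (rule tendsto_mult_right_zero)
  moreover have "\<forall>\<^sub>F k in sequentially. 12 * \<epsilon> k = \<sigma> k ^ 1 * B k"
    using ev1 by eventually_elim (simp add: B_def)
  ultimately have B: "(\<lambda>k. \<sigma> k ^ 1 * B k) \<longlonglongrightarrow> 0"
    by (rule Lim_transform_eventually)
  have "(\<lambda>k. of_real (\<sigma> k ^ (b + 1)) * (cdiff ^^ b) (h k) (of_nat r)) \<longlonglongrightarrow> 0"
    by (rule cdiff_tendsto_0[where c = 1 and h = h and B = B, OF \<sigma> _ hB B]) simp
  then have "(\<lambda>k. of_real (\<sigma> k ^ (b + 1)) * (fdiff ^^ b) (\<lambda>r. h k (of_nat r)) r) \<longlonglongrightarrow> 0"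
    unfolding cdiff_of_nat .
  then have "(\<lambda>k. Re (of_real (\<sigma> k ^ (b + 1)) * (fdiff ^^ b) (\<lambda>r. h k (of_nat r)) r)) \<longlonglongrightarrow> Re 0"
    by (rule tendsto_Re)
  moreover have "(fdiff ^^ b) (\<lambda>r. h k (of_nat r)) r = of_real ((fdiff ^^ b) (\<lambda>r. rel_ratio (I k) (n k) (s k) (real r) - 1) r)" for k
  proof -
    have "h k (of_nat r) = of_real (rel_ratio (I k) (n k) (s k) (real r) - 1)" for r
      using rel_ratio_of_real[of "I k" "n k" "s k" "real r", where 'a = complex] by (simp add: h_def)
    then show ?thesis
      by (simp only: fdiff_of_real)
  qed
  ultimately show ?thesis
    by (simp only: \<sigma>_def Re_complex_of_real zero_complex.sel flip: of_real_mult)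
qed

text \<open>
  Here \<open>\<mu> \<rightarrow> 0\<close> gives no lower bound on the \<open>n i\<close>, and the tree may be as large as \<open>n\<close> itself. Trees with
  \<open>m \<le> sqrt (N / C)\<close> are handled by \<open>moment_ratio_le_param\<close>; for larger ones, the bound
  \<open>N \<rho> ^ l\<close> of \<open>moment_ratio_le_exponential\<close> is used with \<open>l\<close> of order \<open>sqrt N\<close>. If \<open>Suc r\<close> copies of the
  tree do not fit into \<open>n\<close>, the corresponding factorial moment is \<open>0\<close>, and the ratio may be replaced by \<open>0\<close>.
\<close>

lemma moment_ratio_tendsto_0:
  assumes \<mu>: "\<mu> \<longlonglongrightarrow> 0"
  shows "(\<lambda>k. if \<forall>i\<in>I k. Suc r * s k i \<le> n k i then moment_ratio (I k) (n k) (s k) r else 0) \<longlonglongrightarrow> 0"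
proof -
  define q' where "q' = 1 - (1 - q) / real (Suc r)"
  define \<rho> where "\<rho> = 2 * q' / (1 + q')"
  define C where "C = 18 * real (Suc r)"
  define t where "t k = sqrt (real (N k) / C)" for k
  define l where "l k = nat \<lfloor>t k\<rfloor>" for k
  have "(1 - q) / real (Suc r) \<le> (1 - q) / 1"
    using q(2) by (intro divide_left_mono) auto
  then have q': "0 < q'" "q' < 1" using q(1,2) by (auto simp: q'_def)
  have \<rho>: "0 < \<rho>" "\<rho> < 1" using q' by (auto simp: \<rho>_def divide_less_eq)
  have C: "C > 0" by (simp add: C_def)
  have "filterlim (\<lambda>k. real (N k)) at_top sequentially"
    using size by (rule filterlim_compose[OF filterlim_real_sequentially])
  then have "filterlim (\<lambda>k. real (N k) * (1 / C)) at_top sequentially"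
    using C by (intro filterlim_at_top_mult_tendsto_pos[where c = "1 / C"]) auto
  then have t: "filterlim t at_top sequentially"
    unfolding t_def by (intro filterlim_compose[OF sqrt_at_top]) simp
  have lt: "real (l k) \<le> t k" "t k < real (l k) + 1" for k
  proof -
    have "t k \<ge> 0" using C by (simp add: t_def sum_nonneg)
    then show "real (l k) \<le> t k" "t k < real (l k) + 1"
      using floor_correct[of "t k"] by (auto simp: l_def of_nat_nat)
  qed
  have "filterlim (\<lambda>k. real (l k + 1)) at_top sequentially"
  proof (rule filterlim_at_top_mono[OF t], intro always_eventually allI)
    show "t k \<le> real (l k + 1)" for k using lt(2)[of k] by simp
  qed
  then have l1: "filterlim (\<lambda>k. l k + 1) at_top sequentially"
    by (simp only: filterlim_sequentially_iff_filterlim_real)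
  have "\<forall>\<^sub>F k in sequentially. t k > 1 / (1 - q')"
    using t[unfolded filterlim_at_top_dense] by blast
  then have bound: "\<forall>\<^sub>F k in sequentially.
     norm (if \<forall>i\<in>I k. Suc r * s k i \<le> n k i then moment_ratio (I k) (n k) (s k) r else 0)
       \<le> 2 * \<mu> k + C * (real (l k + 1) ^ 2 * \<rho> ^ (l k + 1 - 1))"
    using q(3) m_pos
  proof eventually_elim
    case (elim k)
    have \<mu>0: "\<mu> k \<ge> 0" by (simp add: param_def prod_nonneg sum_nonneg)
    have t2: "t k ^ 2 = real (N k) / C" using C by (simp add: t_def sum_nonneg)
    have t0: "t k \<ge> 0" using C by (simp add: t_def sum_nonneg)
    show ?case
    proof (cases "\<forall>i\<in>I k. Suc r * s k i \<le> n k i")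
      case sn: True
      have ge0: "0 \<le> moment_ratio (I k) (n k) (s k) r"
        by (rule moment_ratio_nonneg[OF fin]) (use sn in blast)
      have "moment_ratio (I k) (n k) (s k) r \<le> 2 * \<mu> k + C * (real (l k + 1) ^ 2 * \<rho> ^ (l k + 1 - 1))"
      proof (cases "C * real (m k) ^ 2 \<le> real (N k)")
        case True
        have "moment_ratio (I k) (n k) (s k) r \<le> 2 * \<mu> k"
        proof (rule moment_ratio_le_param[OF fin])
          show "Suc r * s k i \<le> n k i" if "i \<in> I k" for i using sn that by blast
        qed (use True elim(3) in \<open>simp_all only: C_def\<close>)
        also have "\<dots> \<le> 2 * \<mu> k + C * (real (l k + 1) ^ 2 * \<rho> ^ (l k + 1 - 1))"
          using C \<rho> by simp
        finally show ?thesis .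
      next
        case False
        then have "real (N k) \<le> real (m k) ^ 2 * C" by (simp only: mult.commute not_le less_imp_le)
        then have "t k ^ 2 \<le> real (m k) ^ 2" by (simp only: t2 pos_divide_le_eq[OF C])
        then have "t k \<le> real (m k)" by (rule power2_le_imp_le) (rule of_nat_0_le_iff)
        then have "real (l k) \<le> real (m k)" using lt(1)[of k] by linarith
        then have lm: "l k \<le> m k" by (simp only: of_nat_le_iff)
        have "1 \<le> (1 - q') * t k" using elim(1) q' by (simp add: divide_less_eq mult.commute)
        then have "t k * 1 \<le> t k * ((1 - q') * t k)" using t0 by (rule mult_left_mono)
        also have "\<dots> = (1 - q') * (real (N k) / C)"
          unfolding t2[symmetric] by (simp only: power2_eq_square mult_ac)
        also have "\<dots> \<le> (1 - q') / 2 * (real (N k) / real (Suc r))"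
        proof -
          have "real (N k) / C \<le> real (N k) / (2 * real (Suc r))"
            by (intro divide_left_mono) (auto simp: C_def simp del: of_nat_sum)
          then have "(1 - q') * (real (N k) / C) \<le> (1 - q') * (real (N k) / (2 * real (Suc r)))"
            using q' by (intro mult_left_mono) auto
          then show ?thesis by (simp del: of_nat_sum of_nat_Suc)
        qed
        finally have l2: "real (l k) \<le> (1 - q') / 2 * (real (N k) / real (Suc r))"
          using lt(1)[of k] by linarith
        have "moment_ratio (I k) (n k) (s k) r \<le> real (N k) * \<rho> ^ l k"
          unfolding \<rho>_def q'_def
        proof (rule moment_ratio_le_exponential[OF fin])
          show "m k > 0" "q \<le> 1" "l k \<le> m k" using elim(3) q(2) lm by auto
          show "Suc r * s k i \<le> n k i" "real (n k i) \<le> q * real (N k)" if "i \<in> I k" for i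
            using sn elim(2) that by blast+
        qed (use l2 q' in \<open>simp_all only: q'_def less_imp_le\<close>)
        also have "real (N k) = C * t k ^ 2" using C by (simp add: t2 del: of_nat_sum)
        also have "\<dots> \<le> C * real (l k + 1) ^ 2"
          using C t0 lt(2)[of k] by (intro mult_left_mono power_mono) auto
        finally have "moment_ratio (I k) (n k) (s k) r \<le> C * real (l k + 1) ^ 2 * \<rho> ^ l k"
          using \<rho> by (simp add: mult_right_mono)
        then show ?thesis using \<mu>0 by (simp add: mult.assoc)
      qed
      then show ?thesis using ge0 unfolding if_P[OF sn] by simp
    next
      case False
      have "0 \<le> 2 * \<mu> k + C * (real (l k + 1) ^ 2 * \<rho> ^ (l k + 1 - 1))"
        using \<mu>0 C \<rho> by simp
      then show ?thesis unfolding if_not_P[OF False] by simp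
    qed
  qed
  have "(\<lambda>k. 2 * \<mu> k + C * (real (l k + 1) ^ 2 * \<rho> ^ (l k + 1 - 1))) \<longlonglongrightarrow> 2 * 0 + C * 0"
    by (intro tendsto_intros \<mu> square_times_power_tendsto_0[OF \<rho> l1])
  then show ?thesis
    by (intro Lim_null_comparison[OF bound]) simp
qed

end

section \<open>The factorial moments of the fringe tree count\<close>

lemma trees_with_stat_forests: "bij_betw (\<lambda>t. [t]) (trees_with_stat n) (forests n 1)"
proof (rule bij_betwI[where g = hd])
  show "(\<lambda>t. [t]) \<in> trees_with_stat n \<rightarrow> forests n 1"
    by (auto simp: trees_with_stat_def forests_def fun_eq_iff)
  show "hd \<in> forests n 1 \<rightarrow> trees_with_stat n"
    by (auto simp: trees_with_stat_def forests_def fun_eq_iff length_Suc_conv)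
qed (auto simp: forests_def length_Suc_conv)

lemma sum_choose_fringe_count:
  "(\<Sum>t\<in>trees_with_stat n. fringe_count S t choose r) = forest_moment S r n 1"
  unfolding forest_moment_def
  using sum.reindex_bij_betw[OF trees_with_stat_forests, of "\<lambda>ts. forest_count S ts choose r" n] by simp

lemma forest_weight_1: "forest_weight 1 t = fact (t - 1)"
  by (simp add: forest_weight_def)

text \<open>
  Dividing the closed form for \<open>k = 1\<close> by its value at \<open>r = 0\<close>, the number of all trees, turns quotients
  of factorials into falling factorials.
\<close>

lemma fmoment_fringe_count:
  assumes n: "is_deg_stat n" and I: "finite I" "{i. n i \<noteq> 0} \<subseteq> I" "{i. tree_deg_stat S i \<noteq> 0} \<subseteq> I"
  shows "fmoment (random_tree n) (fringe_count S) r = fact_moment I n (tree_deg_stat S) r"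
    and "finite (set_pmf (random_tree n))"
proof -
  define s where "s = tree_deg_stat S"
  define N m where "N = sum n I" and "m = sum s I"
  have sums: "(\<Sum>i | n i \<noteq> 0. g i * n i) = (\<Sum>i\<in>I. g i * n i)" for g :: "nat \<Rightarrow> nat"
    using I by (intro sum.mono_neutral_left) auto
  have bal: "sum n I = 1 + (\<Sum>i\<in>I. i * n i)"
    using n sums[of "\<lambda>_. 1"] sums[of "\<lambda>i. i"] by (simp add: is_deg_stat_def)
  have N: "N > 0" using bal by (simp add: N_def)
  have m: "m > 0" using sum_tree_deg_stat[of S I] I tree_size_pos[of S]
    by (simp add: m_def s_def)
  have cnt: "real (\<Sum>t\<in>trees_with_stat n. fringe_count S t choose r) =
     (if \<forall>i. r * s i \<le> n i
      then fact (r + (\<Sum>i\<in>I. n i - r * s i) - 1) / (fact r * (\<Prod>i\<in>I. fact (n i - r * s i)))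
      else 0)" for r
  proof -
    have "i \<in> I" if "n i \<noteq> 0" for i using I(2) that by auto
    from forest_moment_eq[OF I(1) this bal, of S r] show ?thesis
      unfolding sum_choose_fringe_count s_def forest_weight_1 .
  qed
  have fin: "finite (trees_with_stat n)"
    using n bij_betw_finite[OF trees_with_stat_forests] finite_forests[of n 1] by (simp add: is_deg_stat_def)
  have card: "real (card (trees_with_stat n)) = fact (N - 1) / (\<Prod>i\<in>I. fact (n i))"
    using cnt[of 0] by (simp add: N_def)
  have "(\<Prod>i\<in>I. fact (n i) :: real) > 0" by (intro prod_pos) auto
  then have "real (card (trees_with_stat n)) \<noteq> 0" unfolding card by simp
  then have ne: "trees_with_stat n \<noteq> {}" by auto
  show "finite (set_pmf (random_tree n))"
    by (simp add: random_tree_def set_pmf_of_set ne fin)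
  have "fmoment (random_tree n) (fringe_count S) r =
     (\<Sum>t\<in>trees_with_stat n. fact r * real (fringe_count S t choose r)) / card (trees_with_stat n)"
    by (simp add: fmoment_def random_tree_def integral_pmf_of_set[OF ne fin] ffall_choose sum_distrib_left)
  also have "\<dots> = fact r * real (\<Sum>t\<in>trees_with_stat n. fringe_count S t choose r) / card (trees_with_stat n)"
    by (simp add: sum_distrib_left)
  also have "\<dots> = fact_moment I n s r"
  proof (cases "\<forall>i. r * s i \<le> n i")
    case True
    have rm: "r * m \<le> N" unfolding m_def N_def sum_distrib_left using True by (intro sum_mono) auto
    then have rm1: "r * (m - 1) \<le> N - 1"
    proof (cases r)
      case (Suc r')
      then have "r * (m - 1) + r = r * m" using m by (simp add: algebra_simps flip: mult_Suc_right)
      then show ?thesis using rm Suc by linarith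
    qed simp
    have exponent: "r + (\<Sum>i\<in>I. n i - r * s i) - 1 = N - 1 - r * (m - 1)"
    proof -
      have "(\<Sum>i\<in>I. n i - r * s i) = N - r * m"
        using True by (simp add: sum_subtractf_nat sum_distrib_left N_def m_def)
      moreover have "r * (m - 1) + r = r * m" using m by (cases m) auto
      ultimately show ?thesis using rm N by linarith
    qed
    have "ffall (real (n i)) (r * s i) = fact (n i) / fact (n i - r * s i)" for i
      using True by (intro ffall_fact) auto
    then have num: "(\<Prod>i\<in>I. ffall (real (n i)) (r * s i)) = (\<Prod>i\<in>I. fact (n i)) / (\<Prod>i\<in>I. fact (n i - r * s i))"
      by (simp add: prod_dividef)
    have den: "ffall (real N - 1) (r * (m - 1)) = fact (N - 1) / fact (N - 1 - r * (m - 1))"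
      using ffall_fact[OF rm1] N by (simp add: of_nat_diff)
    show ?thesis
      unfolding cnt if_P[OF True] card fact_moment_def N_def[symmetric] m_def[symmetric] exponent num den
      by simp
  next
    case False
    then obtain i where i: "n i < r * s i" by (auto simp: not_le)
    then have "s i \<noteq> 0" by (metis mult_0_right not_less_zero)
    then have "i \<in> I" using I by (auto simp: s_def)
    then have "(\<Prod>i\<in>I. ffall (real (n i)) (r * s i)) = 0"
      using I(1) ffall_eq_0[OF i] by (intro prod_zero) auto
    then have "fact_moment I n s r = 0" by (simp add: fact_moment_def)
    then show ?thesis unfolding cnt if_not_P[OF False] by simp
  qed
  finally show "fmoment (random_tree n) (fringe_count S) r = fact_moment I n (tree_deg_stat S) r"
    by (simp add: s_def)
qed

lemma fringe_param_eq_param: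
  assumes I: "finite I" "{i. n i \<noteq> 0} \<subseteq> I" "{i. tree_deg_stat S i \<noteq> 0} \<subseteq> I"
  shows "fringe_param n S = param I n (tree_deg_stat S)"
proof -
  have N: "stat_size n = sum n I"
    unfolding stat_size_def using I by (intro sum.mono_neutral_left) auto
  have "tree_weight (emp_dist n) S = (\<Prod>i\<in>I. emp_dist n i ^ tree_deg_stat S i)"
    unfolding tree_weight_def using I by (intro prod.mono_neutral_left) auto
  then show ?thesis by (simp add: fringe_param_def param_def emp_dist_def N)
qed

text \<open>
  Degrees \<open>i \<ge> 2\<close> make up at most half of the vertices, because a vertex of degree \<open>i\<close> has \<open>i\<close>
  children; for degrees \<open>0\<close> and \<open>1\<close> the bound comes from the limit distribution.
\<close>

lemma degree_bound:
  fixes n :: "nat \<Rightarrow> nat \<Rightarrow> nat" and p :: "nat pmf"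
  assumes deg_stat: "\<And>k. k \<ge> 1 \<Longrightarrow> is_deg_stat (n k)"
    and emp_lim: "\<And>i. (\<lambda>k. emp_dist (n k) i) \<longlonglongrightarrow> pmf p i"
    and p0: "pmf p 0 < 1" and p1: "pmf p 1 < 1"
  obtains q :: real where "0 < q" "q < 1"
    "\<forall>\<^sub>F k in sequentially. \<forall>i. real (n k i) \<le> q * real (stat_size (n k))"
proof -
  define q where "q = Max {1/2, (1 + pmf p 0) / 2, (1 + pmf p 1) / 2}"
  have q: "1/2 \<le> q" "(1 + pmf p 0) / 2 \<le> q" "(1 + pmf p 1) / 2 \<le> q"
    unfolding q_def by (intro Max_ge; simp)+
  have average: "a < q" if "(1 + a) / 2 \<le> q" "a < 1" for a :: real
    using that by simp
  have "pmf p 0 < q" "pmf p 1 < q" using average q(2,3) p0 p1 by blast+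
  have "q < 1" unfolding q_def using p0 p1 by (subst Max_less_iff) auto
  have "\<forall>\<^sub>F k in sequentially. emp_dist (n k) 0 < q"
    using order_tendstoD(2)[OF emp_lim \<open>pmf p 0 < q\<close>] .
  moreover have "\<forall>\<^sub>F k in sequentially. emp_dist (n k) 1 < q"
    using order_tendstoD(2)[OF emp_lim \<open>pmf p 1 < q\<close>] .
  ultimately have "\<forall>\<^sub>F k in sequentially. \<forall>i. real (n k i) \<le> q * real (stat_size (n k))"
    using eventually_ge_at_top[of 1]
  proof eventually_elim
    case (elim k)
    have stat: "finite {i. n k i \<noteq> 0}" "stat_size (n k) = 1 + (\<Sum>i | n k i \<noteq> 0. i * n k i)"
      using deg_stat[OF elim(3)] by (auto simp: is_deg_stat_def stat_size_def)
    then have "stat_size (n k) > 0" by linarith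
    then have pos: "real (stat_size (n k)) > 0" by simp
    show ?case
    proof
      fix i :: nat
      consider "i = 0" | "i = 1" | "i \<ge> 2" by linarith
      then show "real (n k i) \<le> q * real (stat_size (n k))"
      proof cases
        case 3
        have "i * n k i \<le> stat_size (n k)"
        proof (cases "n k i = 0")
          case False
          then have "i * n k i \<le> (\<Sum>i | n k i \<noteq> 0. i * n k i)"
            using stat(1) by (intro member_le_sum[where f = "\<lambda>i. i * n k i"]) auto
          then show ?thesis using stat(2) by simp
        qed simp
        moreover have "2 * n k i \<le> i * n k i" using 3 by (rule mult_right_mono) simp
        ultimately have "2 * n k i \<le> stat_size (n k)" by linarith
        then have "real (n k i) \<le> 1/2 * real (stat_size (n k))" by linarith
        also have "\<dots> \<le> q * real (stat_size (n k))" using q(1) by (intro mult_right_mono) auto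
        finally show ?thesis .
      qed (use elim(1,2) pos in \<open>simp_all add: emp_dist_def divide_less_eq\<close>)
    qed
  qed
  then show ?thesis using that[of q] q(1) \<open>q < 1\<close> by simp
qed

lemma fmoment_mean_var:
  assumes fin: "finite (set_pmf P)"
  shows "measure_pmf.expectation P (\<lambda>w. real (X w)) = fmoment P X 1"
    and "measure_pmf.variance P (\<lambda>w. real (X w)) = fmoment P X 2 + fmoment P X 1 - fmoment P X 1 ^ 2"
proof -
  have int: "integrable (measure_pmf P) f" for f :: "'a \<Rightarrow> real"
    using fin by (intro integrable_measure_pmf_finite)
  show mean: "measure_pmf.expectation P (\<lambda>w. real (X w)) = fmoment P X 1"
    by (simp add: fmoment_def ffall_def)
  have "fmoment P X 2 + fmoment P X 1 = measure_pmf.expectation P (\<lambda>w. real (X w) ^ 2)"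
    unfolding fmoment_def Bochner_Integration.integral_add[OF int int, symmetric]
    by (simp add: ffall_def numeral_2_eq_2 algebra_simps)
  then show "measure_pmf.variance P (\<lambda>w. real (X w)) = fmoment P X 2 + fmoment P X 1 - fmoment P X 1 ^ 2"
    using measure_pmf.variance_eq[OF int int, of "\<lambda>w. real (X w)"] mean by simp
qed

lemma asymp_equiv_mult_tendsto_1:
  fixes w f :: "nat \<Rightarrow> real"
  assumes "w \<longlonglongrightarrow> 1" "\<forall>\<^sub>F k in sequentially. g k = w k * f k"
  shows "g \<sim>[sequentially] f"
proof -
  have "(\<lambda>k. w k * f k) \<sim>[sequentially] (\<lambda>k. 1 * f k)"
    using assms(1) by (intro asymp_equiv_mult tendsto_imp_asymp_equiv_const asymp_equiv_refl) auto
  moreover have "g \<sim>[sequentially] (\<lambda>k. w k * f k)"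
    using assms(2) by (rule asymp_equiv_refl_ev)
  ultimately show ?thesis by (auto intro: asymp_equiv_trans)
qed

theorem theorem3p2:
  fixes n :: "nat \<Rightarrow> nat \<Rightarrow> nat" and p :: "nat pmf" and T :: "nat \<Rightarrow> ptree"
  assumes deg_stat: "\<And>k. k \<ge> 1 \<Longrightarrow> is_deg_stat (n k)"
    and size_n: "filterlim (\<lambda>k. stat_size (n k)) at_top sequentially"
    and emp_lim: "\<And>i. (\<lambda>k. emp_dist (n k) i) \<longlonglongrightarrow> pmf p i"
    and p0: "pmf p 0 < 1" and p1: "pmf p 1 < 1"
    and size_T: "filterlim (\<lambda>k. tree_size (T k)) at_top sequentially"
  shows
    "(\<forall>r\<ge>0. (\<lambda>k. fringe_param (n k) (T k)) \<longlonglongrightarrow> r \<longrightarrow>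
        weak_conv_m (\<lambda>k. law (random_tree (n k)) (\<lambda>t. real (fringe_count (T k) t)))
                    (law (Po r) real) \<and>
        (\<forall>j::nat. (\<lambda>k. measure_pmf.expectation (random_tree (n k))
                           (\<lambda>t. real (fringe_count (T k) t) ^ j))
                    \<longlonglongrightarrow> measure_pmf.expectation (Po r) (\<lambda>x. real x ^ j)) \<and>
        (\<lambda>k. fringe_mean (n k) (T k)) \<sim>[sequentially] (\<lambda>k. fringe_var (n k) (T k)) \<and>
        (r > 0 \<longrightarrow>
          (\<lambda>k. fringe_var (n k) (T k)) \<sim>[sequentially] (\<lambda>k. fringe_param (n k) (T k))))
     \<and>
     (filterlim (\<lambda>k. fringe_param (n k) (T k)) at_top sequentially \<longrightarrow>
        weak_conv_m (\<lambda>k. law (random_tree (n k)) (normalized_count (n k) (T k)))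
                    std_normal_distribution \<and>
        (\<lambda>k. measure_pmf.expectation (random_tree (n k)) (normalized_count (n k) (T k)))
          \<longlonglongrightarrow> prob_space.expectation std_normal_distribution (\<lambda>x. x) \<and>
        (\<lambda>k. measure_pmf.variance (random_tree (n k)) (normalized_count (n k) (T k)))
          \<longlonglongrightarrow> prob_space.variance std_normal_distribution (\<lambda>x. x) \<and>
        (\<lambda>k. fringe_mean (n k) (T k)) \<sim>[sequentially] (\<lambda>k. fringe_var (n k) (T k)) \<and>
        (\<lambda>k. fringe_var (n k) (T k)) \<sim>[sequentially] (\<lambda>k. fringe_param (n k) (T k)))"
proof -
  define s where "s k = tree_deg_stat (T k)" for k
  \<comment> \<open>The index \<open>0\<close> is not covered by the hypothesis on \<open>n\<close>; the conditional keeps \<open>I k\<close> finite there.\<close>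
  define I where "I k = (if is_deg_stat (n k) then {i. n k i \<noteq> 0} \<union> {i. s k i \<noteq> 0} else {})" for k
  define P where "P k = random_tree (n k)" for k
  define X where "X k = fringe_count (T k)" for k
  define \<mu> where "\<mu> k = fringe_param (n k) (T k)" for k
  define F where "F k r = fmoment (P k) (X k) r" for k r
  define \<rho> where "\<rho> k r = (if \<forall>i\<in>I k. Suc r * s k i \<le> n k i then moment_ratio (I k) (n k) (s k) r else 0)" for k r
  have I: "finite (I k)" for k
    using finite_tree_deg_stat[of "T k"] by (auto simp: I_def is_deg_stat_def s_def)
  have I1: "{i. n k i \<noteq> 0} \<subseteq> I k" "{i. tree_deg_stat (T k) i \<noteq> 0} \<subseteq> I k" if "k \<ge> 1" for k
    using deg_stat[OF that] by (auto simp: I_def s_def)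
  have ge1: "\<forall>\<^sub>F k in sequentially. (1::nat) \<le> k" by (rule eventually_ge_at_top)
  have N: "stat_size (n k) = sum (n k) (I k)" if "k \<ge> 1" for k
    unfolding stat_size_def using I I1[OF that] by (intro sum.mono_neutral_left) auto
  have m: "tree_size (T k) = sum (s k) (I k)" if "k \<ge> 1" for k
    using sum_tree_deg_stat[of "T k" "I k"] I1[OF that] I by (simp add: s_def)
  have \<mu>_eq: "\<mu> k = param (I k) (n k) (s k)" if "k \<ge> 1" for k
    unfolding \<mu>_def s_def using I I1[OF that] by (rule fringe_param_eq_param)
  have F_eq: "F k r = fact_moment (I k) (n k) (s k) r" if "k \<ge> 1" for k r
    unfolding F_def P_def X_def s_def
    using deg_stat[OF that] I I1[OF that] by (rule fmoment_fringe_count)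
  have fin_k: "finite (set_pmf (P k))" if "k \<ge> 1" for k
    unfolding P_def using deg_stat[OF that] I I1[OF that] by (rule fmoment_fringe_count)
  have fin_ev: "\<forall>\<^sub>F k in sequentially. finite (set_pmf (P k))"
    using ge1 by eventually_elim (rule fin_k)
  obtain q where q: "0 < q" "q < 1" "\<forall>\<^sub>F k in sequentially. \<forall>i. real (n k i) \<le> q * real (stat_size (n k))"
    using degree_bound[OF deg_stat emp_lim p0 p1] by blast
  interpret degree_sequences I n s q
  proof
    show "filterlim (\<lambda>k. sum (n k) (I k)) at_top sequentially"
      using size_n by (rule filterlim_cong[OF refl refl, THEN iffD1, rotated])
        (use ge1 in \<open>eventually_elim, simp add: N\<close>)
    show "filterlim (\<lambda>k. sum (s k) (I k)) at_top sequentially"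
      using size_T by (rule filterlim_cong[OF refl refl, THEN iffD1, rotated])
        (use ge1 in \<open>eventually_elim, simp add: m\<close>)
    show "\<forall>\<^sub>F k in sequentially. \<forall>i\<in>I k. real (n k i) \<le> q * real (sum (n k) (I k))"
      using q(3) ge1 by eventually_elim (simp add: N)
  qed (use I q in auto)
  have F_Suc: "F k (Suc r) = \<rho> k r * F k r" if "k \<ge> 1" for k r
  proof (cases "\<forall>i\<in>I k. Suc r * s k i \<le> n k i")
    case False
    then obtain i where i: "i \<in> I k" "n k i < Suc r * s k i" by (auto simp: not_le)
    have "(\<Prod>i\<in>I k. ffall (real (n k i)) (Suc r * s k i)) = 0"
      using I i(1) ffall_eq_0[OF i(2)] by (intro prod_zero) auto
    then show ?thesis unfolding F_eq[OF that] \<rho>_def if_not_P[OF False] by (simp add: fact_moment_def)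
  qed (simp add: F_eq[OF that] \<rho>_def fact_moment_Suc)
  have F_0: "F k 0 = 1" for k by (simp add: F_def fmoment_def)
  have mean: "fringe_mean (n k) (T k) = F k 1"
    and var: "fringe_var (n k) (T k) = F k 2 + F k 1 - F k 1 ^ 2" if "k \<ge> 1" for k
    using fmoment_mean_var[OF fin_k[OF that], of "X k"]
    by (simp_all add: fringe_mean_def fringe_var_def F_def P_def X_def)

  have poisson: "weak_conv_m (\<lambda>k. law (P k) (\<lambda>t. real (X k t))) (law (Po r) real) \<and>
        (\<forall>j::nat. (\<lambda>k. measure_pmf.expectation (P k) (\<lambda>t. real (X k t) ^ j))
                    \<longlonglongrightarrow> measure_pmf.expectation (Po r) (\<lambda>x. real x ^ j)) \<and>
        (\<lambda>k. fringe_mean (n k) (T k)) \<sim>[sequentially] (\<lambda>k. fringe_var (n k) (T k)) \<and>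
        (r > 0 \<longrightarrow> (\<lambda>k. fringe_var (n k) (T k)) \<sim>[sequentially] \<mu>)"
    if r: "r \<ge> 0" and lim: "\<mu> \<longlonglongrightarrow> r" for r
  proof -
    have lim': "(\<lambda>k. param (I k) (n k) (s k)) \<longlonglongrightarrow> r"
      using lim by (rule Lim_transform_eventually) (use ge1 in \<open>eventually_elim, simp add: \<mu>_eq\<close>)
    \<comment> \<open>For \<open>r > 0\<close> the ratio itself converges; for \<open>r = 0\<close> it may have to be replaced by \<open>0\<close>.\<close>
    obtain \<kappa> where \<kappa>: "\<And>l. (\<lambda>k. \<kappa> k l) \<longlonglongrightarrow> r" "\<And>k l. k \<ge> 1 \<Longrightarrow> F k (Suc l) = \<kappa> k l * F k l"
    proof (cases "r > 0")
      case True
      show ?thesis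
        by (rule that[of "\<lambda>k l. moment_ratio (I k) (n k) (s k) l"])
          (use moment_ratio_tendsto_pos[OF lim' True] in \<open>simp_all add: F_eq fact_moment_Suc\<close>)
    next
      case False
      then have "r = 0" using r by simp
      have "(\<lambda>k. \<rho> k l) \<longlonglongrightarrow> 0" for l
        using moment_ratio_tendsto_0[of l] lim' unfolding \<open>r = 0\<close> \<rho>_def by blast
      then show ?thesis
        using that[of \<rho>] F_Suc unfolding \<open>r = 0\<close> by blast
    qed
    have F_lim: "(\<lambda>k. F k l) \<longlonglongrightarrow> r ^ l" for l
    proof (induction l)
      case (Suc l)
      have "(\<lambda>k. \<kappa> k l * F k l) \<longlonglongrightarrow> r * r ^ l"
        by (intro tendsto_mult \<kappa>(1) Suc)
      moreover have "\<forall>\<^sub>F k in sequentially. \<kappa> k l * F k l = F k (Suc l)"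
        using ge1 by eventually_elim (simp add: \<kappa>(2))
      ultimately show ?case unfolding power_Suc by (rule Lim_transform_eventually)
    qed (simp add: F_0)
    \<comment> \<open>As \<open>F k 2 = \<kappa> k 1 * F k 1\<close>, the variance is \<open>w\<close> times the mean; no division is involved, so
      this covers a vanishing mean.\<close>
    define w where "w k = \<kappa> k 1 + 1 - F k 1" for k
    have "w \<longlonglongrightarrow> r + 1 - r ^ 1"
      unfolding w_def by (intro tendsto_intros \<kappa>(1) F_lim)
    then have w: "w \<longlonglongrightarrow> 1" by simp
    have var_w: "fringe_var (n k) (T k) = w k * fringe_mean (n k) (T k)" if "k \<ge> 1" for k
      using \<kappa>(2)[OF that, of 1]
      by (simp add: mean[OF that] var[OF that] w_def numeral_2_eq_2 algebra_simps)
    have "(\<lambda>k. fringe_var (n k) (T k)) \<sim>[sequentially] (\<lambda>k. fringe_mean (n k) (T k))"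
      by (rule asymp_equiv_mult_tendsto_1[OF w]) (use ge1 in \<open>eventually_elim, simp add: var_w\<close>)
    moreover have "(\<lambda>k. fringe_var (n k) (T k)) \<sim>[sequentially] \<mu>" if "r > 0"
    proof -
      have "(\<lambda>k. w k * F k 1) \<longlonglongrightarrow> 1 * r ^ 1"
        by (intro tendsto_mult w F_lim)
      then have "(\<lambda>k. w k * F k 1) \<longlonglongrightarrow> r" by simp
      then have "(\<lambda>k. fringe_var (n k) (T k)) \<longlonglongrightarrow> r"
        by (rule Lim_transform_eventually) (use ge1 in \<open>eventually_elim, simp add: var_w mean\<close>)
      then have "(\<lambda>k. fringe_var (n k) (T k)) \<sim>[sequentially] (\<lambda>_. r)"
        using that by (intro tendsto_imp_asymp_equiv_const) auto
      moreover have "\<mu> \<sim>[sequentially] (\<lambda>_. r)"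
        using lim that by (intro tendsto_imp_asymp_equiv_const) auto
      ultimately show ?thesis by (meson asymp_equiv_sym asymp_equiv_trans)
    qed
    moreover have "weak_conv_m (\<lambda>k. law (P k) (\<lambda>t. real (X k t))) (law (Po r) real)"
      using fin_ev r F_lim unfolding F_def by (rule poisson_weak_conv)
    moreover have "(\<lambda>k. measure_pmf.expectation (P k) (\<lambda>t. real (X k t) ^ j))
                    \<longlonglongrightarrow> measure_pmf.expectation (Po r) (\<lambda>x. real x ^ j)" for j
      using fin_ev r F_lim unfolding F_def by (rule poisson_moments)
    ultimately show ?thesis by (simp add: asymp_equiv_sym)
  qed

  have normal: "weak_conv_m (\<lambda>k. law (P k) (normalized_count (n k) (T k))) std_normal_distribution \<and>
        (\<lambda>k. measure_pmf.expectation (P k) (normalized_count (n k) (T k)))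
          \<longlonglongrightarrow> prob_space.expectation std_normal_distribution (\<lambda>x. x) \<and>
        (\<lambda>k. measure_pmf.variance (P k) (normalized_count (n k) (T k)))
          \<longlonglongrightarrow> prob_space.variance std_normal_distribution (\<lambda>x. x) \<and>
        (\<lambda>k. fringe_mean (n k) (T k)) \<sim>[sequentially] (\<lambda>k. fringe_var (n k) (T k)) \<and>
        (\<lambda>k. fringe_var (n k) (T k)) \<sim>[sequentially] \<mu>"
    if lim: "filterlim \<mu> at_top sequentially"
  proof -
    define \<eta> where "\<eta> k r = rel_ratio (I k) (n k) (s k) (real r) - 1" for k r
    define Y where "Y k t = (real (X k t) - \<mu> k) / sqrt (\<mu> k)" for k t
    define a where "a k = measure_pmf.expectation (P k) (Y k)" for k
    define v where "v k = measure_pmf.expectation (P k) (\<lambda>t. Y k t ^ 2)" for k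
    have Y_eq: "normalized_count (n k) (T k) = Y k" for k
      by (auto simp: normalized_count_def Y_def X_def \<mu>_def)
    have \<mu>pos: "\<forall>\<^sub>F k in sequentially. \<mu> k > 0"
      using lim[unfolded filterlim_at_top_dense] by blast
    have lim': "filterlim (\<lambda>k. param (I k) (n k) (s k)) at_top sequentially"
      using lim by (rule filterlim_cong[OF refl refl, THEN iffD1, rotated])
        (use ge1 in \<open>eventually_elim, simp add: \<mu>_eq\<close>)
    have mom: "(\<lambda>k. measure_pmf.expectation (P k) (\<lambda>t. Y k t ^ j)) \<longlonglongrightarrow> (LINT x|std_normal_distribution. x ^ j)" for j
      unfolding Y_def
    proof (rule normal_moments[OF fin_ev lim])
      show "\<forall>\<^sub>F k in sequentially. \<forall>r. fmoment (P k) (X k) (Suc r) = \<mu> k * (1 + \<eta> k r) * fmoment (P k) (X k) r"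
        using ge1 \<mu>pos moment_ratio_rel
      proof eventually_elim
        case (elim k)
        then show ?case
          by (simp add: F_eq[unfolded F_def] fact_moment_Suc \<mu>_eq \<eta>_def)
      qed
      show "(\<lambda>k. sqrt (\<mu> k) ^ (b + 1) * (fdiff ^^ b) (\<eta> k) r) \<longlonglongrightarrow> 0" for b r
      proof (rule Lim_transform_eventually[OF rel_ratio_fdiff_tendsto[OF lim', of b r]])
        show "\<forall>\<^sub>F k in sequentially. sqrt (param (I k) (n k) (s k)) ^ (b + 1) *
            (fdiff ^^ b) (\<lambda>r. rel_ratio (I k) (n k) (s k) (real r) - 1) r = sqrt (\<mu> k) ^ (b + 1) * (fdiff ^^ b) (\<eta> k) r"
          using ge1 by eventually_elim (simp only: \<mu>_eq \<eta>_def[abs_def])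
      qed
    qed
    have N1: "(LINT x|std_normal_distribution. x) = 0"
      using integral_std_normal_distribution_moment_odd[of 1] by simp
    have N2: "(LINT x|std_normal_distribution. x ^ 2) = 1"
      using std_normal_distribution_even_moments(1)[of 1] by simp
    have a: "a \<longlonglongrightarrow> 0"
      using mom[of 1] N1 by (simp add: a_def[abs_def])
    have v: "v \<longlonglongrightarrow> 1"
      using mom[of 2] N2 by (simp add: v_def[abs_def])
    have va: "(\<lambda>k. v k - a k ^ 2) \<longlonglongrightarrow> 1"
      using tendsto_diff[OF v tendsto_power[OF a, of 2]] by simp
    have varY: "measure_pmf.variance (P k) (Y k) = v k - a k ^ 2" if "k \<ge> 1" for k
      unfolding v_def a_def using fin_k[OF that]
      by (intro measure_pmf.variance_eq integrable_measure_pmf_finite)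
    have "weak_conv_m (\<lambda>k. law (P k) (Y k)) std_normal_distribution"
      using fin_ev mom by (rule normal_weak_conv)
    moreover have "(\<lambda>k. measure_pmf.variance (P k) (Y k)) \<longlonglongrightarrow> 1"
      using va by (rule Lim_transform_eventually) (use ge1 in \<open>eventually_elim, simp add: varY\<close>)
    moreover have "(\<lambda>k. fringe_mean (n k) (T k)) \<sim>[sequentially] \<mu>"
    proof (rule asymp_equiv_mult_tendsto_1)
      have "(\<lambda>k. 1 + a k * inverse (sqrt (\<mu> k))) \<longlonglongrightarrow> 1 + 0 * 0"
        by (intro tendsto_intros a tendsto_inverse_0_at_top filterlim_compose[OF sqrt_at_top lim])
      then show "(\<lambda>k. 1 + a k * inverse (sqrt (\<mu> k))) \<longlonglongrightarrow> 1" by simp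
      show "\<forall>\<^sub>F k in sequentially. fringe_mean (n k) (T k) = (1 + a k * inverse (sqrt (\<mu> k))) * \<mu> k"
        using ge1 \<mu>pos
      proof eventually_elim
        case (elim k)
        have "a k = (F k 1 - \<mu> k) / sqrt (\<mu> k)"
          using fmoment_mean_var(1)[OF fin_k[OF elim(1)], of "X k"]
            integrable_measure_pmf_finite[OF fin_k[OF elim(1)], of "\<lambda>t. real (X k t)"]
          by (simp add: a_def Y_def[abs_def] F_def)
        then have "F k 1 = \<mu> k + a k * sqrt (\<mu> k)" using elim(2) by (simp add: field_simps)
        moreover have "inverse (sqrt (\<mu> k)) * \<mu> k = sqrt (\<mu> k)"
          using real_div_sqrt[of "\<mu> k"] elim(2) by (simp add: divide_inverse mult.commute)
        ultimately show ?case by (simp add: mean[OF elim(1)] distrib_right mult.assoc)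
      qed
    qed
    moreover have "(\<lambda>k. fringe_var (n k) (T k)) \<sim>[sequentially] \<mu>"
    proof (rule asymp_equiv_mult_tendsto_1[OF va])
      show "\<forall>\<^sub>F k in sequentially. fringe_var (n k) (T k) = (v k - a k ^ 2) * \<mu> k"
        using ge1 \<mu>pos
      proof eventually_elim
        case (elim k)
        define e where "e = measure_pmf.expectation (P k) (\<lambda>t. real (X k t))"
        have a_eq: "a k = (e - \<mu> k) / sqrt (\<mu> k)"
          using integrable_measure_pmf_finite[OF fin_k[OF elim(1)], of "\<lambda>t. real (X k t)"]
          by (simp add: a_def Y_def[abs_def] e_def)
        have "(real (X k t) - e)\<^sup>2 = \<mu> k * (Y k t - a k)\<^sup>2" for t
        proof -
          have "Y k t - a k = (real (X k t) - e) / sqrt (\<mu> k)"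
            unfolding Y_def a_eq by (simp add: diff_divide_distrib)
          then show ?thesis using elim(2) by (simp add: power_divide)
        qed
        then have "fringe_var (n k) (T k) = \<mu> k * measure_pmf.variance (P k) (Y k)"
          by (simp add: fringe_var_def P_def[symmetric] X_def[symmetric] e_def[symmetric] a_def[symmetric])
        then show ?case by (simp add: varY[OF elim(1)])
      qed
    qed
    ultimately show ?thesis
      using a N1 N2 unfolding Y_eq a_def[abs_def] by (simp add: asymp_equiv_sym) (meson asymp_equiv_sym asymp_equiv_trans)
  qed
  show ?thesis
    using poisson normal unfolding P_def X_def \<mu>_def[abs_def] by blast
qed

end
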